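(* Consider the utility maximization problem $$\text{(A)}\quad \max_{\mathbf w(\mathbf s)}\ U(\gamma_1,\dots,\gamma_K)\quad\text{s.t.}\quad \sum_{k=1}^K\int_{\mathcal S}|w_k(\mathbf s)|^2\,d\mathbf s\le P,$$ and the power minimization problem $$\text{(B)}\quad \min_{\mathbf w(\mathbf s)}\ \sum_{k=1}^K\int_{\mathcal S}|w_k(\mathbf s)|^2\,d\mathbf s\quad\text{s.t.}\quad \gamma_k\ge\eta_k,\ \forall k.$$ The optimal solution to problems (A) and (B) can be expressed as $$\mathbf w(\mathbf s)=\mathbf h(\mathbf s)\left(\mathbf I_K+\frac{1}{\sigma^2}\mathbf\Lambda\mathbf Q\right)^{-1}\mathbf P^{\frac12},$$ where $\mathbf h(\mathbf s)=[h_1(\mathbf s),\dots,h_K(\mathbf s)]\in\mathbb C^{1\times K}$ is the channel vector, $\mathbf Q\in\mathbb C^{K\times K}$ is the channel correlation matrix with entries $[\mathbf Q]_{k,i}=\int_{\mathcal S}h_i(\mathbf s)h_k^*(\mathbf s)\,d\mathbf s$, satisfying $\mathbf Q=\mathbf Q^H$, and $\mathbf\Lambda=\mathrm{diag}(\lambda_1,\dots,\lambda_K)\in\mathbb R_+^{K\times K}$ and $\mathbf P=\mathrm{diag}(p_1,\dots,p_K)\in\mathbb R_+^{K\times K}$ are two diagonal matrices. Additionally, $$\sum_{k=1}^K\lambda_k=P,$$ i.e., the sum of the $\lambda$-parameters equals the maximum available transmit power.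
   Context: $\mathcal S$ is the continuous radiating surface of a transmitter serving $K$ single-antenna users. $h_k(\mathbf s)\in\mathbb C$ is the channel response between the point $\mathbf s\in\mathcal S$ and user $k$. The optimization variables are the continuous beamformers $w_k(\mathbf s)\in\mathbb C$, $\mathbf s\in\mathcal S$, collected in $\mathbf w(\mathbf s)=[w_1(\mathbf s),\dots,w_K(\mathbf s)]\in\mathbb C^{1\times K}$. The signal-to-interference-plus-noise ratio (SINR) of user $k$ is $$\gamma_k=\frac{\left|\int_{\mathcal S}h_k^*(\mathbf s)w_k(\mathbf s)\,d\mathbf s\right|^2}{\sum_{i\ne k}\left|\int_{\mathcal S}h_k^*(\mathbf s)w_i(\mathbf s)\,d\mathbf s\right|^2+\sigma^2},$$ where $\sigma^2$ is the noise power and $^*$ denotes complex conjugation. $U$ is a system utility function that is strictly monotonically increasing in each argument $\gamma_k$. The scalar $P$ is the transmit power budget (distinct from the diagonal matrix $\mathbf P$). In (B), $\eta_k$ is the minimum SINR required by user $k$; the two problems are connected by substituting for $\eta_k$ the optimal value $\gamma_k^\star$ from (A), under which their optimal solutions share the same structure. $\mathbf I_K$ is the $K\times K$ identity matrix, $(\cdot)^H$ is the conjugate transpose, and $\mathbb R_+$ is the set of non-negative real numbers. *)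

theory Defs
  imports "HOL-Analysis.Analysis"
begin

text \<open>The radiating surface is a measure space \<open>S\<close>: its points are the points of the surface and
  its measure is the surface element \<open>ds\<close>. The users are the elements of a finite type \<open>'k\<close>, and a
  row vector of \<open>K\<close> functions on the surface is a function into \<open>complex ^ 'k\<close>.\<close>

definition square_integrable :: "'a measure \<Rightarrow> ('a \<Rightarrow> complex) \<Rightarrow> bool" where
  "square_integrable S f \<longleftrightarrow>
     f \<in> borel_measurable S \<and> integrable S (\<lambda>s. (cmod (f s))\<^sup>2)"

definition link :: "'a measure \<Rightarrow> ('a \<Rightarrow> complex) \<Rightarrow> ('a \<Rightarrow> complex) \<Rightarrow> complex" where
  "link S f g = (LINT s|S. cnj (f s) * g s)"

definition sinr ::
  "'a measure \<Rightarrow> ('a \<Rightarrow> complex ^ 'k::finite) \<Rightarrow> real \<Rightarrow> ('a \<Rightarrow> complex ^ 'k) \<Rightarrow> real ^ 'k" where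
  "sinr S h \<sigma> w = (\<chi> k.
     (cmod (link S (\<lambda>s. h s $ k) (\<lambda>s. w s $ k)))\<^sup>2 /
     ((\<Sum>i \<in> UNIV - {k}. (cmod (link S (\<lambda>s. h s $ k) (\<lambda>s. w s $ i)))\<^sup>2) + \<sigma>\<^sup>2))"

definition transmit_power :: "'a measure \<Rightarrow> ('a \<Rightarrow> complex ^ 'k::finite) \<Rightarrow> real" where
  "transmit_power S w = (\<Sum>k \<in> UNIV. LINT s|S. (cmod (w s $ k))\<^sup>2)"

text \<open>Since the Bochner integral of a non-integrable function is \<open>0\<close>, finiteness of the transmit
  power has to be part of being a beamformer.\<close>

definition beamformer :: "'a measure \<Rightarrow> ('a \<Rightarrow> complex ^ 'k::finite) \<Rightarrow> bool" where
  "beamformer S w \<longleftrightarrow> (\<forall>k. square_integrable S (\<lambda>s. w s $ k))"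

text \<open>SINR values are non-negative, so monotonicity is only required on the non-negative orthant.\<close>

definition strictly_increasing_in_each :: "(real ^ 'k::finite \<Rightarrow> real) \<Rightarrow> bool" where
  "strictly_increasing_in_each U \<longleftrightarrow>
     (\<forall>x k t. (\<forall>i. 0 \<le> x $ i) \<and> x $ k < t \<longrightarrow> U x < U (\<chi> i. if i = k then t else x $ i))"

definition utility_optimal ::
  "'a measure \<Rightarrow> ('a \<Rightarrow> complex ^ 'k::finite) \<Rightarrow> real \<Rightarrow> (real ^ 'k \<Rightarrow> real) \<Rightarrow> real \<Rightarrow>
     ('a \<Rightarrow> complex ^ 'k) \<Rightarrow> bool" where
  "utility_optimal S h \<sigma> U P =
     is_arg_max (\<lambda>w. U (sinr S h \<sigma> w)) (\<lambda>w. beamformer S w \<and> transmit_power S w \<le> P)"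

definition power_optimal ::
  "'a measure \<Rightarrow> ('a \<Rightarrow> complex ^ 'k::finite) \<Rightarrow> real \<Rightarrow> real ^ 'k \<Rightarrow>
     ('a \<Rightarrow> complex ^ 'k) \<Rightarrow> bool" where
  "power_optimal S h \<sigma> \<eta> =
     is_arg_min (transmit_power S) (\<lambda>w. beamformer S w \<and> (\<forall>k. \<eta> $ k \<le> sinr S h \<sigma> w $ k))"

definition conj_transpose :: "complex ^ 'n ^ 'm \<Rightarrow> complex ^ 'm ^ 'n" where
  "conj_transpose A = (\<chi> i j. cnj (A $ j $ i))"

definition real_diag :: "real ^ 'k \<Rightarrow> complex ^ 'k ^ 'k::finite" where
  "real_diag d = (\<chi> i j. if i = j then complex_of_real (d $ i) else 0)"

definition channel_correlation ::
  "'a measure \<Rightarrow> ('a \<Rightarrow> complex ^ 'k::finite) \<Rightarrow> complex ^ 'k ^ 'k" where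
  "channel_correlation S h = (\<chi> k i. link S (\<lambda>s. h s $ k) (\<lambda>s. h s $ i))"

definition regularized_matrix ::
  "'a measure \<Rightarrow> ('a \<Rightarrow> complex ^ 'k::finite) \<Rightarrow> real \<Rightarrow> real ^ 'k \<Rightarrow> complex ^ 'k ^ 'k" where
  "regularized_matrix S h \<sigma> l =
     mat 1 + (1 / \<sigma>\<^sup>2) *\<^sub>R (real_diag l ** channel_correlation S h)"

definition structured_beamformer ::
  "'a measure \<Rightarrow> ('a \<Rightarrow> complex ^ 'k::finite) \<Rightarrow> real \<Rightarrow> real ^ 'k \<Rightarrow> real ^ 'k \<Rightarrow>
     'a \<Rightarrow> complex ^ 'k" where
  "structured_beamformer S h \<sigma> l p = (\<lambda>s.
     h s v* (matrix_inv (regularized_matrix S h \<sigma> l) ** real_diag (\<chi> k. sqrt (p $ k))))"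

text \<open>SINRs and power do not change when a user's beamformer is multiplied by a unimodular constant
  or altered on a null set, so optimal beamformers can be unique only in the following sense.\<close>

definition same_up_to_phases ::
  "'a measure \<Rightarrow> ('a \<Rightarrow> complex ^ 'k::finite) \<Rightarrow> ('a \<Rightarrow> complex ^ 'k) \<Rightarrow> bool" where
  "same_up_to_phases S v w \<longleftrightarrow>
     (\<exists>c :: complex ^ 'k. (\<forall>k. cmod (c $ k) = 1) \<and> (AE s in S. \<forall>k. v s $ k = c $ k * w s $ k))"

end

(*
  Scaling down one user's beamformer shows that at an optimum of (B) every positive SINR target is
  attained with equality and users with a non-positive target are switched off. By separation, the
  first-order variations of power and SINR margins admit multipliers; testing them with the
  variation w itself shows that the multiplier of the power is positive and that the
  lambda-parameters add up to the power. Stationarity says (I + Lambda Q / sigma^2) x_k = beta_k e_k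
  for the coefficients x_k of w_k in the channels. For these multipliers the Lagrangian is a sum of
  positive semidefinite quadratic forms, the k-th with kernel spanned by w_k, so any other optimum is
  w_k scaled by alpha_k; since all SINR targets are tight for both, a maximum principle gives
  |alpha_k| = 1. An optimum of (A) exhausts the power budget unless the channel vanishes, hence it is
  an optimum of (B) for its own SINRs.
*)

theory Submission
  imports Defs
begin

section \<open>Square-integrable functions\<close>

lemma borel_measurable_cnj [measurable (raw)]:
  assumes "f \<in> borel_measurable M"
  shows "(\<lambda>x. cnj (f x)) \<in> borel_measurable M"
  using assms by (rule borel_measurable_continuous_on[rotated]) (intro continuous_intros)

lemma square_integrable_add:
  assumes "square_integrable S f" "square_integrable S g"
  shows "square_integrable S (\<lambda>s. f s + g s)"
proof -
  have [measurable]: "f \<in> borel_measurable S" "g \<in> borel_measurable S"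
    using assms by (auto simp: square_integrable_def)
  have "integrable S (\<lambda>s. 2 * (cmod (f s))\<^sup>2 + 2 * (cmod (g s))\<^sup>2)"
    using assms by (auto simp: square_integrable_def)
  moreover have "(cmod (f s + g s))\<^sup>2 \<le> 2 * (cmod (f s))\<^sup>2 + 2 * (cmod (g s))\<^sup>2" for s
  proof -
    have "(cmod (f s + g s))\<^sup>2 \<le> (cmod (f s) + cmod (g s))\<^sup>2"
      by (simp add: norm_triangle_ineq power_mono)
    also have "\<dots> \<le> 2 * (cmod (f s))\<^sup>2 + 2 * (cmod (g s))\<^sup>2"
      using sum_squares_bound[of "cmod (f s)" "cmod (g s)"] by (simp add: power2_sum)
    finally show ?thesis .
  qed
  ultimately have "integrable S (\<lambda>s. (cmod (f s + g s))\<^sup>2)"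
    by (intro Bochner_Integration.integrable_bound[where g = "\<lambda>s. (cmod (f s + g s))\<^sup>2"]) auto
  then show ?thesis by (simp add: square_integrable_def)
qed

lemma square_integrable_cmult:
  assumes "square_integrable S f"
  shows "square_integrable S (\<lambda>s. c * f s)"
  using assms by (auto simp: square_integrable_def norm_mult power_mult_distrib)

lemma square_integrable_zero: "square_integrable S (\<lambda>s. 0)"
  by (simp add: square_integrable_def)

lemma square_integrable_diff:
  assumes "square_integrable S f" "square_integrable S g"
  shows "square_integrable S (\<lambda>s. f s - g s)"
  using square_integrable_add[OF assms(1) square_integrable_cmult[OF assms(2), of "-1"]] by simp

lemma square_integrable_sum:
  assumes "\<And>i. i \<in> I \<Longrightarrow> square_integrable S (f i)"
  shows "square_integrable S (\<lambda>s. \<Sum>i\<in>I. f i s)"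
  using assms
  by (induction I rule: infinite_finite_induct)
     (auto intro: square_integrable_add square_integrable_zero)

lemmas square_integrable_intros =
  square_integrable_add square_integrable_diff square_integrable_cmult square_integrable_zero
  square_integrable_sum

lemma integrable_link:
  assumes "square_integrable S f" "square_integrable S g"
  shows "integrable S (\<lambda>s. cnj (f s) * g s)"
proof -
  have [measurable]: "f \<in> borel_measurable S" "g \<in> borel_measurable S"
    using assms by (auto simp: square_integrable_def)
  have "integrable S (\<lambda>s. (cmod (f s))\<^sup>2 + (cmod (g s))\<^sup>2)"
    using assms by (auto simp: square_integrable_def)
  moreover have "cmod (cnj (f s) * g s) \<le> (cmod (f s))\<^sup>2 + (cmod (g s))\<^sup>2" for s
    using sum_squares_bound[of "cmod (f s)" "cmod (g s)"]
      mult_nonneg_nonneg[OF norm_ge_zero[of "f s"] norm_ge_zero[of "g s"]]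
    unfolding norm_mult complex_mod_cnj by linarith
  ultimately show ?thesis
    by (intro Bochner_Integration.integrable_bound[where g = "\<lambda>s. cnj (f s) * g s"]) auto
qed

lemma link_add_right:
  assumes "square_integrable S f" "square_integrable S g" "square_integrable S u"
  shows "link S f (\<lambda>s. g s + u s) = link S f g + link S f u"
  using assms by (simp add: link_def distrib_left integrable_link)

lemma link_diff_right:
  assumes "square_integrable S f" "square_integrable S g" "square_integrable S u"
  shows "link S f (\<lambda>s. g s - u s) = link S f g - link S f u"
  using assms by (simp add: link_def right_diff_distrib integrable_link)

lemma link_cmult_right: "link S f (\<lambda>s. c * g s) = c * link S f g"
  by (simp add: link_def mult.left_commute)

lemma link_zero_right: "link S f (\<lambda>s. 0) = 0"
  by (simp add: link_def)

lemma link_sum_right: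
  assumes "square_integrable S f" "\<And>i. i \<in> I \<Longrightarrow> square_integrable S (g i)"
  shows "link S f (\<lambda>s. \<Sum>i\<in>I. g i s) = (\<Sum>i\<in>I. link S f (g i))"
  using assms
  by (simp add: link_def sum_distrib_left Bochner_Integration.integral_sum integrable_link)

lemma link_commute: "link S g f = cnj (link S f g)"
  by (simp add: link_def mult.commute flip: Bochner_Integration.integral_cnj)

lemma link_add_left:
  assumes "square_integrable S f" "square_integrable S g" "square_integrable S u"
  shows "link S (\<lambda>s. g s + u s) f = link S g f + link S u f"
  using link_add_right[OF assms]
  by (metis complex_cnj_add link_commute)

lemma link_diff_left:
  assumes "square_integrable S f" "square_integrable S g" "square_integrable S u"
  shows "link S (\<lambda>s. g s - u s) f = link S g f - link S u f"
  using link_diff_right[OF assms]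
  by (metis complex_cnj_diff link_commute)

lemma link_cmult_left: "link S (\<lambda>s. c * g s) f = cnj c * link S g f"
  by (metis complex_cnj_mult link_cmult_right link_commute)

lemma link_sum_left:
  assumes "square_integrable S f" "\<And>i. i \<in> I \<Longrightarrow> square_integrable S (g i)"
  shows "link S (\<lambda>s. \<Sum>i\<in>I. g i s) f = (\<Sum>i\<in>I. link S (g i) f)"
  by (subst link_commute, subst link_sum_right[OF assms])
     (auto simp: cnj_sum intro!: sum.cong link_commute[symmetric])

lemma link_cong_AE:
  assumes "square_integrable S f" "square_integrable S f'"
    "square_integrable S g" "square_integrable S g'"
    and "AE s in S. f s = f' s" "AE s in S. g s = g' s"
  shows "link S f g = link S f' g'"
proof -
  have [measurable]: "f \<in> borel_measurable S" "g \<in> borel_measurable S"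
    "f' \<in> borel_measurable S" "g' \<in> borel_measurable S"
    using assms by (auto simp: square_integrable_def)
  show ?thesis
    unfolding link_def by (rule integral_cong_AE) (use assms(5,6) in auto)
qed

text \<open>The squared L2 norm as a real number, so that order arguments apply;
  \<open>link_self\<close> ties it to the complex inner product \<open>link\<close>.\<close>

definition energy :: "'a measure \<Rightarrow> ('a \<Rightarrow> complex) \<Rightarrow> real" where
  "energy S f = (LINT s|S. (cmod (f s))\<^sup>2)"

lemma energy_nonneg: "0 \<le> energy S f"
  by (simp add: energy_def)

lemma link_self: "link S f f = complex_of_real (energy S f)"
proof -
  have "cnj z * z = complex_of_real ((cmod z)\<^sup>2)" for z
    by (simp add: complex_norm_square mult.commute del: of_real_power)
  then show ?thesis
    unfolding link_def energy_def
    by (simp del: of_real_power)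
qed

lemma energy_zero: "energy S (\<lambda>s. 0) = 0"
  by (simp add: energy_def)

lemma energy_cmult: "energy S (\<lambda>s. c * f s) = (cmod c)\<^sup>2 * energy S f"
  by (simp add: energy_def norm_mult power_mult_distrib)

lemma energy_add:
  assumes "square_integrable S f" "square_integrable S g"
  shows "energy S (\<lambda>s. f s + g s) = energy S f + energy S g + 2 * Re (link S f g)"
proof -
  have "complex_of_real (energy S (\<lambda>s. f s + g s)) =
      link S f f + link S g g + (link S f g + cnj (link S f g))"
    using assms
    by (simp add: link_self[symmetric] link_add_left link_add_right square_integrable_intros
        link_commute[of S g f])
  also have "\<dots> = complex_of_real (energy S f + energy S g + 2 * Re (link S f g))"
    by (simp add: link_self complex_add_cnj)
  finally show ?thesis using of_real_eq_iff by blast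
qed

lemma energy_eq_0_iff:
  assumes "square_integrable S f"
  shows "energy S f = 0 \<longleftrightarrow> (AE s in S. f s = 0)"
  unfolding energy_def
  using assms by (subst integral_nonneg_eq_0_iff_AE) (auto simp: square_integrable_def)

lemma energy_cong_AE:
  assumes "square_integrable S f" "square_integrable S g" "AE s in S. f s = g s"
  shows "energy S f = energy S g"
  using link_cong_AE[OF assms(1,2,1,2,3,3)] by (simp add: link_self)

lemma transmit_power_energy: "transmit_power S w = (\<Sum>k\<in>UNIV. energy S (\<lambda>s. w s $ k))"
  by (simp add: transmit_power_def energy_def)

lemma transmit_power_nonneg: "0 \<le> transmit_power S w"
  by (simp add: transmit_power_energy sum_nonneg energy_nonneg)

section \<open>Lagrange multipliers for a linear system of inequalities\<close>

text \<open>The subspace misses the open convex cone \<open>C\<close> of strict descent with strict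
  gain on \<open>A\<close>, so a hyperplane separates them. Its normal gives multipliers of Fritz
  John type: the pair is non-trivial, but \<mu> may still be zero.\<close>

lemma subspace_multipliers:
  fixes L :: "(real \<times> (real ^ 'k::finite)) set"
  assumes L: "subspace L"
    and disj: "\<And>a b. (a, b) \<in> L \<Longrightarrow> a < 0 \<Longrightarrow> \<exists>k\<in>A. b $ k \<le> 0"
  obtains \<mu> :: real and \<nu> :: "real ^ 'k" where "0 \<le> \<mu>" "\<And>k. 0 \<le> \<nu> $ k" "\<And>k. k \<notin> A \<Longrightarrow> \<nu> $ k = 0"
    "\<mu> \<noteq> 0 \<or> \<nu> \<noteq> 0" "\<And>a b. (a, b) \<in> L \<Longrightarrow> \<mu> * a = \<nu> \<bullet> b"
proof -
  define C where "C = {x :: real \<times> (real ^ 'k). fst x < 0 \<and> (\<forall>k\<in>A. 0 < snd x $ k)}"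
  have "convex C"
    unfolding C_def convex_alt
    apply (auto simp: mult_less_0_iff)
     apply (smt (verit, ccfv_threshold) mult_nonneg_nonpos mult_pos_neg)
    apply (smt (verit, ccfv_threshold) mult_nonneg_nonneg mult_pos_pos)
    done
  moreover have "(-1, \<chi> i. 1) \<in> C" by (simp add: C_def)
  moreover have "L \<inter> C = {}" using disj by (force simp: C_def)
  moreover have "L \<noteq> {}" using subspace_0[OF L] by auto
  ultimately obtain a b where a: "a \<noteq> 0" "\<forall>x\<in>L. a \<bullet> x \<le> b" "\<forall>x\<in>C. b \<le> a \<bullet> x"
    using separating_hyperplane_sets[of L C] subspace_imp_convex[OF L] by blast
  have "0 \<le> b" using a(2) subspace_0[OF L] by fastforce
  \<comment> \<open>A linear functional bounded above by \<open>b\<close> on a subspace vanishes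
    there: otherwise some multiple of \<open>x\<close> would reach the value
    \<open>b + 1\<close>.\<close>
  have zero: "a \<bullet> x = 0" if "x \<in> L" for x
  proof (rule ccontr)
    assume "a \<bullet> x \<noteq> 0"
    moreover have "((b + 1) / (a \<bullet> x)) *\<^sub>R x \<in> L" using L that by (rule subspace_mul)
    then have "a \<bullet> (((b + 1) / (a \<bullet> x)) *\<^sub>R x) \<le> b" using a(2) by blast
    ultimately show False by simp
  qed
  \<comment> \<open>Non-negativity passes to the closed cone: adding a small multiple of the
    interior point \<open>(-1, \<chi> i. 1)\<close> moves \<open>z\<close> into \<open>C\<close>,
    and \<open>t\<close> keeps the error below \<open>e\<close>.\<close>
  have cone: "0 \<le> a \<bullet> z" if "fst z \<le> 0" "\<And>k. k \<in> A \<Longrightarrow> 0 \<le> snd z $ k" for z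
  proof (rule field_le_epsilon)
    fix e :: real assume e: "0 < e"
    define q where "q = a \<bullet> (-1, \<chi> i. 1)"
    define t where "t = e / (\<bar>q\<bar> + 1)"
    have t: "0 < t" "t * q \<le> e"
      using e mult_left_mono[of q "\<bar>q\<bar> + 1" e] by (auto simp: t_def field_simps)
    have "t *\<^sub>R (-1, \<chi> i. 1) + z \<in> C"
      using that t by (auto simp: C_def intro!: add_pos_nonneg)
    then have "b \<le> t * q + a \<bullet> z"
      using a(3) by (simp only: q_def flip: inner_add_right inner_scaleR_right)
    with \<open>0 \<le> b\<close> t show "0 \<le> a \<bullet> z + e" by linarith
  qed
  show thesis
  proof
    show "0 \<le> - fst a" using cone[of "(-1, 0)"] by (simp add: inner_prod_def)
    show "0 \<le> snd a $ k" for k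
    proof -
      have "0 \<le> a \<bullet> (0, axis k 1)" by (rule cone) (auto simp: axis_def)
      then show ?thesis by (simp add: inner_prod_def inner_axis)
    qed
    \<comment> \<open>Outside \<open>A\<close> the cone leaves the coordinate free, so it contains
      both signs of the axis vector and the coefficient must be zero.\<close>
    moreover have "snd a $ k \<le> 0" if "k \<notin> A" for k
    proof -
      have "0 \<le> a \<bullet> (0, axis k (-1))" by (rule cone) (use that in \<open>auto simp: axis_def\<close>)
      then show ?thesis by (simp add: inner_prod_def inner_axis)
    qed
    ultimately show "snd a $ k = 0" if "k \<notin> A" for k
      using that by (meson order_antisym)
    show "- fst a \<noteq> 0 \<or> snd a \<noteq> 0" using a(1) by (auto simp: prod_eq_iff)
    show "- fst a * x = snd a \<bullet> y" if "(x, y) \<in> L" for x y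
      using zero[OF that] by (simp add: inner_prod_def)
  qed
qed

section \<open>Link gains and optimality conditions\<close>

lemma beamformer_component: "beamformer S w \<Longrightarrow> square_integrable S (\<lambda>s. w s $ k)"
  by (simp add: beamformer_def)

lemma power_optimalD:
  assumes "power_optimal S h \<sigma> \<eta> w"
  shows "beamformer S w" "\<eta> $ k \<le> sinr S h \<sigma> w $ k"
    "\<lbrakk>beamformer S v; \<And>k. \<eta> $ k \<le> sinr S h \<sigma> v $ k\<rbrakk> \<Longrightarrow> transmit_power S w \<le> transmit_power S v"
  using assms by (auto simp: power_optimal_def is_arg_min_def not_less)

text \<open>Serves exact expansions of second order divided by the step \<open>t\<close>:
  \<open>a\<close> is the first-order term, and its sign prevails for small
  \<open>t\<close>.\<close>

lemma eventually_at_right_affine_pos: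
  assumes "0 < (a :: real)"
  shows "\<forall>\<^sub>F t in at_right 0. 0 < a + t * b"
proof -
  have "((\<lambda>t. a + t * b) \<longlongrightarrow> a + 0 * b) (at_right 0)"
    by (intro tendsto_intros)
  then show ?thesis using assms by (auto dest: order_tendstoD(1))
qed

lemma cmod_add_square: "(cmod (a + b))\<^sup>2 = (cmod a)\<^sup>2 + (cmod b)\<^sup>2 + 2 * Re (cnj a * b)"
  by (simp add: cmod_power2 power2_sum algebra_simps)

text \<open>At an index where \<open>x\<close> is largest, the weighted sum is at most
  \<open>x j\<close> times the total weight, so the equation leaves \<open>x j * r \<le> r\<close>;
  the smallest value is treated symmetrically. The alternative \<open>x k = 1\<close> is for users
  without an active target.\<close>

lemma maximum_principle:
  fixes x :: "'k::finite \<Rightarrow> real" and a :: "'k \<Rightarrow> 'k \<Rightarrow> real"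
  assumes a: "\<And>k i. 0 \<le> a k i" and r: "0 < r"
    and eq: "\<And>k. x k = 1 \<or>
      x k * ((\<Sum>i\<in>UNIV - {k}. a k i) + r) = (\<Sum>i\<in>UNIV - {k}. x i * a k i) + r"
  shows "x k = 1"
proof (rule antisym)
  have "Max (range x) \<in> range x" by (intro Max_in) auto
  then obtain j where j: "Max (range x) = x j" by blast
  have le: "x i \<le> x j" for i unfolding j[symmetric] by (rule Max_ge) auto
  have "x j \<le> 1"
  proof (cases "x j = 1")
    case False
    have "(\<Sum>i\<in>UNIV - {j}. x i * a j i) \<le> x j * (\<Sum>i\<in>UNIV - {j}. a j i)"
      unfolding sum_distrib_left using le a by (intro sum_mono mult_right_mono) auto
    then have "x j * r \<le> 1 * r" using eq[of j] False by (simp add: distrib_left)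
    with r show ?thesis by (simp only: mult_le_cancel_right_pos)
  qed simp
  with le show "x k \<le> 1" by (rule order_trans)
  have "Min (range x) \<in> range x" by (intro Min_in) auto
  then obtain j where j: "Min (range x) = x j" by blast
  have ge: "x j \<le> x i" for i unfolding j[symmetric] by (rule Min_le) auto
  have "1 \<le> x j"
  proof (cases "x j = 1")
    case False
    have "x j * (\<Sum>i\<in>UNIV - {j}. a j i) \<le> (\<Sum>i\<in>UNIV - {j}. x i * a j i)"
      unfolding sum_distrib_left using ge a by (intro sum_mono mult_right_mono) auto
    then have "1 * r \<le> x j * r" using eq[of j] False by (simp add: distrib_left)
    with r show ?thesis by (simp only: mult_le_cancel_right_pos)
  qed simp
  with ge show "1 \<le> x k" by (meson order_trans)
qed

section \<open>Utilities that increase in each argument\<close>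

text \<open>Coordinates are raised from \<open>x\<close> to \<open>y\<close> one at a time. Every
  intermediate vector stays in the non-negative orthant, where monotonicity is available.\<close>

lemma strictly_increasing_mono:
  assumes U: "strictly_increasing_in_each U" and x: "\<And>i. 0 \<le> x $ i" and le: "\<And>i. x $ i \<le> y $ i"
  shows "U x \<le> U y"
proof -
  have "U x \<le> U (\<chi> i. if i \<in> F then y $ i else x $ i)" if "finite F" for F
    using that
  proof induction
    case (insert k F)
    let ?z = "\<chi> i. if i \<in> F then y $ i else x $ i"
    have eq: "(\<chi> i. if i \<in> insert k F then y $ i else x $ i) = (\<chi> i. if i = k then y $ k else ?z $ i)"
      by (auto simp: vec_eq_iff)
    have "U ?z \<le> U (\<chi> i. if i = k then y $ k else ?z $ i)"
    proof (cases "x $ k < y $ k")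
      case True
      moreover have "0 \<le> ?z $ i" for i using x[of i] le[of i] by auto
      ultimately show ?thesis
        using U insert.hyps unfolding strictly_increasing_in_each_def
        by (intro less_imp_le) auto
    next
      case False
      then have "y $ k = x $ k" using le[of k] by simp
      then have "(\<chi> i. if i = k then y $ k else ?z $ i) = ?z"
        using insert.hyps by (auto simp: vec_eq_iff)
      then show ?thesis by simp
    qed
    with insert.IH show ?case unfolding eq by (rule order_trans)
  qed simp
  from this[of UNIV] show ?thesis by simp
qed

lemma strictly_increasing_strict_mono:
  assumes U: "strictly_increasing_in_each U" and x: "\<And>i. 0 \<le> x $ i" and le: "\<And>i. x $ i \<le> y $ i"
    and less: "x $ k < y $ k"
  shows "U x < U y"
proof -
  let ?z = "\<chi> i. if i = k then y $ k else x $ i"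
  have "U x < U ?z" using U x less unfolding strictly_increasing_in_each_def by blast
  also have "U ?z \<le> U y"
    using x le less by (intro strictly_increasing_mono[OF U]) (auto intro: order_trans)
  finally show ?thesis .
qed

section \<open>Equality of beamformers up to phases\<close>

lemma same_up_to_phases_sym:
  assumes "same_up_to_phases S v w" shows "same_up_to_phases S w v"
proof -
  obtain c :: "complex ^ 'b" where c: "\<And>k. cmod (c $ k) = 1"
    and vw: "AE s in S. \<forall>k. v s $ k = c $ k * w s $ k"
    using assms by (auto simp: same_up_to_phases_def)
  have "cnj (c $ k) * c $ k = 1" for k
    using c[of k] complex_norm_square[of "c $ k"] by (simp add: mult.commute)
  with vw have "AE s in S. \<forall>k. w s $ k = (\<chi> k. cnj (c $ k)) $ k * v s $ k"
    by (auto simp flip: mult.assoc elim!: eventually_mono)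
  then show ?thesis using c unfolding same_up_to_phases_def
    by (intro exI[of _ "\<chi> k. cnj (c $ k)"]) auto
qed

lemma same_up_to_phases_trans:
  assumes "same_up_to_phases S u v" "same_up_to_phases S v w"
  shows "same_up_to_phases S u w"
proof -
  obtain c d :: "complex ^ 'b" where c: "\<And>k. cmod (c $ k) = 1" "\<And>k. cmod (d $ k) = 1"
    and uv: "AE s in S. \<forall>k. u s $ k = c $ k * v s $ k"
    and vw: "AE s in S. \<forall>k. v s $ k = d $ k * w s $ k"
    using assms by (auto simp: same_up_to_phases_def)
  from uv vw have "AE s in S. \<forall>k. u s $ k = (\<chi> k. c $ k * d $ k) $ k * w s $ k"
    by eventually_elim (simp add: mult.assoc)
  then show ?thesis using c unfolding same_up_to_phases_def
    by (intro exI[of _ "\<chi> k. c $ k * d $ k"]) (auto simp: norm_mult)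
qed

section \<open>SINRs and their invariance under phases\<close>

locale radiating_surface =
  fixes S :: "'a measure" and h :: "'a \<Rightarrow> complex ^ 'k::finite" and \<sigma> :: real
  assumes channel: "square_integrable S (\<lambda>s. h s $ k)"
    and noise: "0 < \<sigma>"
begin

abbreviation gain :: "('a \<Rightarrow> complex ^ 'k) \<Rightarrow> 'k \<Rightarrow> 'k \<Rightarrow> complex" where
  "gain w k i \<equiv> link S (\<lambda>s. h s $ k) (\<lambda>s. w s $ i)"

abbreviation interference :: "('a \<Rightarrow> complex ^ 'k) \<Rightarrow> 'k \<Rightarrow> real" where
  "interference w k \<equiv> (\<Sum>i\<in>UNIV - {k}. (cmod (gain w k i))\<^sup>2)"

lemma interference_noise_pos: "0 < interference w k + \<sigma>\<^sup>2"
  using noise by (intro add_nonneg_pos sum_nonneg) auto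

text \<open>Clearing the positive denominator turns a SINR target into a quadratic inequality in the
  beamformers, which can be expanded along a direction.\<close>

lemma le_sinr_iff:
  "x \<le> sinr S h \<sigma> w $ k \<longleftrightarrow> x * (interference w k + \<sigma>\<^sup>2) \<le> (cmod (gain w k k))\<^sup>2"
  by (simp add: sinr_def pos_le_divide_eq[OF interference_noise_pos])

lemma sinr_eq_iff:
  "sinr S h \<sigma> w $ k = x \<longleftrightarrow> (cmod (gain w k k))\<^sup>2 = x * (interference w k + \<sigma>\<^sup>2)"
  using interference_noise_pos[where w = w and k = k] by (auto simp: sinr_def divide_eq_eq)

lemma sinr_nonneg: "0 \<le> sinr S h \<sigma> w $ k"
  by (simp add: le_sinr_iff)

text \<open>The factor \<open>c\<close> is any complex number: it is a phase, the zero of a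
  switched-off user, or the ratio between two optima.\<close>

lemma gain_phases:
  assumes "beamformer S v" "beamformer S w" "AE s in S. v s $ i = c * w s $ i"
  shows "gain v k i = c * gain w k i"
  using link_cong_AE[OF channel channel beamformer_component[OF assms(1)]
      square_integrable_cmult[OF beamformer_component[OF assms(2)]] _ assms(3)]
  by (simp add: link_cmult_right)

lemma same_up_to_phases_invariant:
  assumes "beamformer S v" "beamformer S w" "same_up_to_phases S v w"
  shows "sinr S h \<sigma> v = sinr S h \<sigma> w" "transmit_power S v = transmit_power S w"
proof -
  obtain c :: "complex ^ 'k" where c: "\<And>k. cmod (c $ k) = 1"
    and ae: "AE s in S. \<forall>k. v s $ k = c $ k * w s $ k"
    using assms(3) by (auto simp: same_up_to_phases_def)
  have ae': "AE s in S. v s $ k = c $ k * w s $ k" for k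
    using ae by eventually_elim auto
  have "cmod (gain v k i) = cmod (gain w k i)" for k i
    using gain_phases[OF assms(1,2) ae'] c by (simp add: norm_mult)
  then show "sinr S h \<sigma> v = sinr S h \<sigma> w" by (simp add: sinr_def)
  have "energy S (\<lambda>s. v s $ k) = energy S (\<lambda>s. w s $ k)" for k
    using energy_cong_AE[OF beamformer_component[OF assms(1)]
        square_integrable_cmult[OF beamformer_component[OF assms(2)]] ae']
    by (simp add: energy_cmult c)
  then show "transmit_power S v = transmit_power S w" by (simp add: transmit_power_energy)
qed

lemma power_optimal_same_up_to_phases:
  assumes "power_optimal S h \<sigma> \<eta> w" "beamformer S v" "same_up_to_phases S v w"
  shows "power_optimal S h \<sigma> \<eta> v"
  using assms same_up_to_phases_invariant[OF assms(2) power_optimalD(1)[OF assms(1)] assms(3)]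
  by (simp add: power_optimal_def is_arg_min_def)

lemma utility_optimal_same_up_to_phases:
  assumes "utility_optimal S h \<sigma> U P w" "beamformer S v" "same_up_to_phases S v w"
  shows "utility_optimal S h \<sigma> U P v"
proof -
  have "beamformer S w" using assms(1) by (simp add: utility_optimal_def is_arg_max_def)
  then show ?thesis
    using assms same_up_to_phases_invariant[OF assms(2) _ assms(3)]
    by (simp add: utility_optimal_def is_arg_max_def)
qed

section \<open>Tightness of the SINR constraints\<close>

text \<open>Attenuating one user's beamformer lowers the power and the interference seen by the others.\<close>

lemma power_optimal_attenuate:
  assumes opt: "power_optimal S h \<sigma> \<eta> w" and t: "0 \<le> t" "t < 1"
    and le: "\<eta> $ k \<le> t\<^sup>2 * sinr S h \<sigma> w $ k"
  shows "energy S (\<lambda>s. w s $ k) = 0"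
proof -
  define v where "v = (\<lambda>s. \<chi> i. (if i = k then of_real t else 1) * w s $ i)"
  have bw: "beamformer S w" by (rule power_optimalD(1)[OF opt])
  have bv: "beamformer S v"
    unfolding v_def beamformer_def vec_lambda_beta
    using bw by (intro allI square_integrable_cmult) (simp add: beamformer_def)
  have g: "gain v j i = (if i = k then of_real t else 1) * gain w j i" for i j
    unfolding v_def vec_lambda_beta by (rule link_cmult_right)
  have t1: "t\<^sup>2 < 1" using t by (simp add: power_less_one_iff)
  have "\<eta> $ j \<le> sinr S h \<sigma> v $ j" for j
  proof (cases "j = k")
    case True
    \<comment> \<open>A user's own beamformer does not enter its interference, so only the numerator
      shrinks, by the factor \<open>t\<^sup>2\<close> that \<open>le\<close> permits.\<close>
    have "interference v k = interference w k" by (simp add: g)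
    then have "sinr S h \<sigma> v $ k = t\<^sup>2 * sinr S h \<sigma> w $ k"
      by (simp add: sinr_def g norm_mult power_mult_distrib)
    with le True show ?thesis by simp
  next
    case False
    have "interference v j \<le> interference w j"
      using t1 by (intro sum_mono) (auto simp: g norm_mult power_mult_distrib intro: mult_left_le_one_le)
    then have "sinr S h \<sigma> w $ j \<le> sinr S h \<sigma> v $ j"
      using False interference_noise_pos[where w = v and k = j] by (simp add: sinr_def g divide_left_mono)
    with power_optimalD(2)[OF opt] show ?thesis by (rule order_trans)
  qed
  then have "transmit_power S w \<le> transmit_power S v" by (rule power_optimalD(3)[OF opt bv])
  moreover have "energy S (\<lambda>s. v s $ i) = (if i = k then t\<^sup>2 else 1) * energy S (\<lambda>s. w s $ i)" for i
    unfolding v_def vec_lambda_beta by (simp add: energy_cmult)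
  ultimately have "energy S (\<lambda>s. w s $ k) \<le> t\<^sup>2 * energy S (\<lambda>s. w s $ k)"
    unfolding transmit_power_energy by (subst (asm) (1 2) sum.remove[of _ k]) auto
  then have "(1 - t\<^sup>2) * energy S (\<lambda>s. w s $ k) \<le> 0" by (simp add: algebra_simps)
  with t1 energy_nonneg[of S "\<lambda>s. w s $ k"] show ?thesis
    by (simp add: mult_le_0_iff)
qed

lemma gain_energy_zero:
  assumes "beamformer S w" "energy S (\<lambda>s. w s $ i) = 0"
  shows "gain w k i = 0"
proof -
  have "AE s in S. w s $ i = 0 * w s $ i"
    using energy_eq_0_iff[OF beamformer_component[OF assms(1)]] assms(2) by simp
  from gain_phases[OF assms(1,1) this] show ?thesis by simp
qed

text \<open>A non-positive target is met even by silence, so the user can be attenuated to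
  zero.\<close>

lemma power_optimal_inactive:
  assumes "power_optimal S h \<sigma> \<eta> w" "\<eta> $ k \<le> 0"
  shows "energy S (\<lambda>s. w s $ k) = 0"
  using power_optimal_attenuate[OF assms(1), of 0] assms(2) by simp

lemma power_optimal_active:
  assumes opt: "power_optimal S h \<sigma> \<eta> w" and pos: "0 < \<eta> $ k"
  shows "sinr S h \<sigma> w $ k = \<eta> $ k"
proof (rule ccontr)
  let ?\<gamma> = "sinr S h \<sigma> w $ k"
  assume "?\<gamma> \<noteq> \<eta> $ k"
  with power_optimalD(2)[OF opt] have less: "\<eta> $ k < ?\<gamma>" by (simp add: order.strict_iff_order)
  have "energy S (\<lambda>s. w s $ k) = 0"
    \<comment> \<open>This amplitude lowers the SINR of user \<open>k\<close> exactly to its target.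
      It is below 1, so the energy of the beamformer must vanish, and the SINR with it.\<close>
    using less pos by (intro power_optimal_attenuate[OF opt, of "sqrt (\<eta> $ k / ?\<gamma>)"]) auto
  then have "?\<gamma> = 0"
    using gain_energy_zero[OF power_optimalD(1)[OF opt]] by (simp add: sinr_def)
  with less pos show False by simp
qed

section \<open>First-order variations and stationarity\<close>

text \<open>Half the derivative of the transmit power at \<open>w\<close> in the direction
  \<open>d\<close>.\<close>

definition power_slope :: "('a \<Rightarrow> complex ^ 'k) \<Rightarrow> ('a \<Rightarrow> complex ^ 'k) \<Rightarrow> real" where
  "power_slope w d = (\<Sum>k\<in>UNIV. Re (link S (\<lambda>s. w s $ k) (\<lambda>s. d s $ k)))"

text \<open>Half the derivative at \<open>w\<close> along \<open>d\<close> of the margin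
  \<open>(cmod (gain w k k))\<^sup>2 - \<eta> $ k * (interference w k +
  \<sigma>\<^sup>2)\<close>.\<close>

definition margin_slope ::
  "real ^ 'k \<Rightarrow> ('a \<Rightarrow> complex ^ 'k) \<Rightarrow> ('a \<Rightarrow> complex ^ 'k) \<Rightarrow> real ^ 'k" where
  "margin_slope \<eta> w d = (\<chi> k. Re (cnj (gain w k k) * gain d k k) -
     \<eta> $ k * (\<Sum>i\<in>UNIV - {k}. Re (cnj (gain w k i) * gain d k i)))"

text \<open>Both slopes are real-linear in the direction, and beamformers form a real vector space.
  This puts the attainable slopes into the form that \<open>subspace_multipliers\<close>
  expects.\<close>

lemma subspace_slopes:
  assumes "beamformer S w"
  shows "subspace {(power_slope w d, margin_slope \<eta> w d) |d. beamformer S d}"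
  (is "subspace ?L")
proof (rule subspaceI)
  have "beamformer S (\<lambda>s. 0 :: complex ^ 'k)"
    by (simp add: beamformer_def square_integrable_zero)
  moreover have "power_slope w (\<lambda>s. 0) = 0" "margin_slope \<eta> w (\<lambda>s. 0) = 0"
    by (simp_all add: power_slope_def margin_slope_def link_zero_right vec_eq_iff)
  ultimately show "0 \<in> ?L" by (force simp: zero_prod_def)
next
  fix x y assume "x \<in> ?L" "y \<in> ?L"
  then obtain d e where de: "beamformer S d" "beamformer S e"
    and xy: "x = (power_slope w d, margin_slope \<eta> w d)" "y = (power_slope w e, margin_slope \<eta> w e)"
    by auto
  have "beamformer S (\<lambda>s. d s + e s)"
    using de by (simp add: beamformer_def square_integrable_add)
  moreover have "power_slope w (\<lambda>s. d s + e s) = power_slope w d + power_slope w e"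
    using assms de
    by (simp add: power_slope_def link_add_right beamformer_component sum.distrib)
  moreover have "margin_slope \<eta> w (\<lambda>s. d s + e s) = margin_slope \<eta> w d + margin_slope \<eta> w e"
    using de
    by (simp add: margin_slope_def link_add_right beamformer_component channel sum.distrib
        vec_eq_iff distrib_left)
  ultimately show "x + y \<in> ?L" unfolding xy by force
next
  fix c x assume "x \<in> ?L"
  then obtain d where d: "beamformer S d" and x: "x = (power_slope w d, margin_slope \<eta> w d)"
    by auto
  note scale = scaleR_conv_of_real[where 'a = complex]
  have "beamformer S (\<lambda>s. c *\<^sub>R d s)"
    using d by (simp add: beamformer_def scale square_integrable_cmult)
  moreover have "power_slope w (\<lambda>s. c *\<^sub>R d s) = c * power_slope w d"
    by (simp add: power_slope_def scale link_cmult_right sum_distrib_left)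
  moreover have "margin_slope \<eta> w (\<lambda>s. c *\<^sub>R d s) = c *\<^sub>R margin_slope \<eta> w d"
    by (simp add: margin_slope_def scale link_cmult_right sum_distrib_left
        vec_eq_iff right_diff_distrib mult.left_commute)
  ultimately show "c *\<^sub>R x \<in> ?L" unfolding x by force
qed

text \<open>Otherwise a small step along \<open>d\<close> would save power while lifting every
  active margin, which is zero at \<open>w\<close>, above zero. Users with a non-positive target
  stay feasible because SINRs are non-negative.\<close>

lemma no_descent_direction:
  assumes opt: "power_optimal S h \<sigma> \<eta> w" and bd: "beamformer S d"
    and neg: "power_slope w d < 0"
  shows "\<exists>k\<in>{k. 0 < \<eta> $ k}. margin_slope \<eta> w d $ k \<le> 0"
proof (rule ccontr)
  assume "\<not> ?thesis"
  then have pos: "0 < margin_slope \<eta> w d $ k" if "0 < \<eta> $ k" for k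
    using that by (auto simp: not_le)
  have bw: "beamformer S w" by (rule power_optimalD(1)[OF opt])
  \<comment> \<open>The second-order coefficient of the margins: for an active user the margin at
    \<open>w + t d\<close> is exactly
    \<open>t * (2 * margin_slope \<eta> w d $ k + t * E $ k)\<close>.\<close>
  define E where "E = (\<chi> k. (cmod (gain d k k))\<^sup>2 - \<eta> $ k * interference d k)"
  have "\<forall>\<^sub>F t in at_right 0. \<forall>k\<in>{k. 0 < \<eta> $ k}. 0 < 2 * margin_slope \<eta> w d $ k + t * E $ k"
    using pos by (intro eventually_ball_finite ballI eventually_at_right_affine_pos) auto
  moreover have "\<forall>\<^sub>F t in at_right 0. 0 < - 2 * power_slope w d + t * (- transmit_power S d)"
    using neg by (intro eventually_at_right_affine_pos) auto
  moreover have "\<forall>\<^sub>F t in at_right 0. (0::real) < t" by (rule eventually_at_right_less)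
  ultimately have "\<forall>\<^sub>F t in at_right 0. 0 < t \<and>
      (\<forall>k\<in>{k. 0 < \<eta> $ k}. 0 < 2 * margin_slope \<eta> w d $ k + t * E $ k) \<and>
      0 < - 2 * power_slope w d + t * (- transmit_power S d)"
    by eventually_elim auto
  from eventually_happens'[OF trivial_limit_at_right_real this]
  obtain t where t: "0 < t"
      "\<And>k. 0 < \<eta> $ k \<Longrightarrow> 0 < 2 * margin_slope \<eta> w d $ k + t * E $ k"
      "2 * power_slope w d + t * transmit_power S d < 0"
    by auto
  define v where "v = (\<lambda>s. w s + t *\<^sub>R d s)"
  have v: "(\<lambda>s. v s $ k) = (\<lambda>s. w s $ k + of_real t * d s $ k)" for k
    by (simp add: v_def scaleR_conv_of_real[where 'a = complex])
  have bv: "beamformer S v"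
    using bw bd by (simp add: beamformer_def v square_integrable_intros)
  have g: "gain v k i = gain w k i + of_real t * gain d k i" for k i
    using bw bd
    by (simp add: v link_add_right link_cmult_right channel beamformer_component square_integrable_cmult)
  have g2: "(cmod (gain v k i))\<^sup>2 = (cmod (gain w k i))\<^sup>2 + t\<^sup>2 * (cmod (gain d k i))\<^sup>2
      + 2 * t * Re (cnj (gain w k i) * gain d k i)" for k i
    unfolding g cmod_add_square by (simp add: norm_mult power_mult_distrib algebra_simps)
  have "\<eta> $ k \<le> sinr S h \<sigma> v $ k" for k
  proof (cases "0 < \<eta> $ k")
    case True
    have "(cmod (gain w k k))\<^sup>2 = \<eta> $ k * (interference w k + \<sigma>\<^sup>2)"
      using power_optimal_active[OF opt True] sinr_eq_iff by blast
    moreover have "interference v k = interference w k + t\<^sup>2 * interference d k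
        + 2 * t * (\<Sum>i\<in>UNIV - {k}. Re (cnj (gain w k i) * gain d k i))"
      by (simp only: g2 sum.distrib sum_distrib_left)
    ultimately have "(cmod (gain v k k))\<^sup>2 - \<eta> $ k * (interference v k + \<sigma>\<^sup>2) =
        t * (2 * margin_slope \<eta> w d $ k + t * E $ k)"
      unfolding g2[of k k] margin_slope_def E_def vec_lambda_beta by algebra
    also have "0 < \<dots>" using t(1) t(2)[OF True] by (rule mult_pos_pos)
    finally show ?thesis by (simp add: le_sinr_iff)
  next
    case False
    then show ?thesis using sinr_nonneg[of v k] by linarith
  qed
  then have "transmit_power S w \<le> transmit_power S v" by (rule power_optimalD(3)[OF opt bv])
  also have "transmit_power S v =
      transmit_power S w + t * (2 * power_slope w d + t * transmit_power S d)"
  proof -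
    have "energy S (\<lambda>s. v s $ k) = energy S (\<lambda>s. w s $ k) + t\<^sup>2 * energy S (\<lambda>s. d s $ k)
        + 2 * t * Re (link S (\<lambda>s. w s $ k) (\<lambda>s. d s $ k))" for k
      using bw bd
      by (simp add: v energy_add energy_cmult beamformer_component square_integrable_cmult link_cmult_right)
    then show ?thesis
      by (simp add: transmit_power_energy power_slope_def sum.distrib power2_eq_square
          flip: sum_distrib_left) (simp add: algebra_simps)
  qed
  also have "\<dots> < transmit_power S w" using t(1,3) by (simp add: mult_less_0_iff)
  finally show False by simp
qed

text \<open>The Fritz John multipliers are divided by that of the power. Testing with
  \<open>w\<close> itself yields the power identity; testing with a variation of user
  \<open>j\<close> alone yields the stationarity of its beamformer.\<close>

lemma power_optimal_multipliers:
  assumes opt: "power_optimal S h \<sigma> \<eta> w"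
  obtains m :: "real ^ 'k" where "\<And>k. 0 \<le> m $ k" "\<And>k. \<eta> $ k \<le> 0 \<Longrightarrow> m $ k = 0"
    "transmit_power S w = (\<Sum>k\<in>UNIV. m $ k * \<eta> $ k * \<sigma>\<^sup>2)"
    "\<And>j. AE s in S. w s $ j = (\<Sum>k\<in>UNIV.
       (if k = j then m $ j * gain w j j else - (m $ k * \<eta> $ k * gain w k j)) * h s $ k)"
proof -
  let ?L = "{(power_slope w d, margin_slope \<eta> w d) |d. beamformer S d}"
  have bw: "beamformer S w" by (rule power_optimalD(1)[OF opt])
  have disj: "\<exists>k\<in>{k. 0 < \<eta> $ k}. b $ k \<le> 0" if "(a, b) \<in> ?L" "a < 0" for a b
    using no_descent_direction[OF opt] that by blast
  obtain \<mu> :: real and \<nu> :: "real ^ 'k" where \<mu>: "0 \<le> \<mu>" and \<nu>: "\<And>k. 0 \<le> \<nu> $ k"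
    and off: "\<And>k. k \<notin> {k. 0 < \<eta> $ k} \<Longrightarrow> \<nu> $ k = 0"
    and nz: "\<mu> \<noteq> 0 \<or> \<nu> \<noteq> 0" and eq: "\<And>a b. (a, b) \<in> ?L \<Longrightarrow> \<mu> * a = \<nu> \<bullet> b"
    by (rule subspace_multipliers[OF subspace_slopes[OF bw] disj]) blast+
  have slopes: "\<mu> * power_slope w d = (\<Sum>k\<in>UNIV. \<nu> $ k * margin_slope \<eta> w d $ k)"
    if "beamformer S d" for d
    using eq[of "power_slope w d" "margin_slope \<eta> w d"] that by (auto simp: inner_vec_def)
  \<comment> \<open>In the direction \<open>w\<close> the slope of a tight margin is the noise term
    of its constraint; the other users have multiplier zero.\<close>
  have "\<nu> $ k * margin_slope \<eta> w w $ k = \<nu> $ k * \<eta> $ k * \<sigma>\<^sup>2" for k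
  proof (cases "0 < \<eta> $ k")
    case True
    have "(cmod (gain w k k))\<^sup>2 = \<eta> $ k * (interference w k + \<sigma>\<^sup>2)"
      using power_optimal_active[OF opt True] sinr_eq_iff by blast
    moreover have "Re (cnj z * z) = (cmod z)\<^sup>2" for z
      by (simp add: cmod_power2 flip: power2_eq_square)
    ultimately show ?thesis
      by (simp add: margin_slope_def algebra_simps)
  qed (use off in simp)
  then have power: "\<mu> * transmit_power S w = (\<Sum>k\<in>UNIV. \<nu> $ k * \<eta> $ k * \<sigma>\<^sup>2)"
    using slopes[OF bw] by (simp only: power_slope_def transmit_power_energy link_self Re_complex_of_real)
  \<comment> \<open>If \<mu> were zero, a sum of non-negative terms would vanish, forcing each \<nu>
    to vanish against non-triviality.\<close>
  have "\<mu> \<noteq> 0"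
  proof
    assume 0: "\<mu> = 0"
    have "\<nu> $ k * \<eta> $ k * \<sigma>\<^sup>2 = 0" for k
    proof -
      have "0 \<le> \<nu> $ k * \<eta> $ k * \<sigma>\<^sup>2" for k
        using \<nu>[of k] off[of k] by (cases "0 < \<eta> $ k") auto
      then show ?thesis
        using power 0 by (simp add: sum_nonneg_eq_0_iff)
    qed
    then have "\<nu> $ k = 0" for k
      using noise off[of k] by (cases "0 < \<eta> $ k") (auto, metis less_irrefl)
    with nz 0 show False by (simp add: vec_eq_iff)
  qed
  define m where "m = (1 / \<mu>) *\<^sub>R \<nu>"
  have \<nu>m: "\<nu> $ k = \<mu> * m $ k" for k using \<open>\<mu> \<noteq> 0\<close> by (simp add: m_def)
  show thesis
  proof
    show "0 \<le> m $ k" for k using \<mu> \<nu> by (simp add: m_def)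
    show "m $ k = 0" if "\<eta> $ k \<le> 0" for k using off that by (simp add: m_def)
    show "transmit_power S w = (\<Sum>k\<in>UNIV. m $ k * \<eta> $ k * \<sigma>\<^sup>2)"
      using power \<open>\<mu> \<noteq> 0\<close> by (simp add: \<nu>m mult.assoc flip: sum_distrib_left)
    fix j
    define b where "b = (\<lambda>k. if k = j then m $ j * gain w j j else - (m $ k * \<eta> $ k * gain w k j))"
    \<comment> \<open>The residual of the stationarity equation serves as the variation of user
      \<open>j\<close>: the multiplier identity then says that the energy of \<open>r\<close> is
      zero.\<close>
    define r where "r = (\<lambda>s. w s $ j - (\<Sum>k\<in>UNIV. b k * h s $ k))"
    have sq: "square_integrable S (\<lambda>s. \<Sum>k\<in>UNIV. b k * h s $ k)"
      by (intro square_integrable_intros channel)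
    have r: "square_integrable S r"
      unfolding r_def by (intro square_integrable_diff beamformer_component[OF bw] sq)
    define d where "d = (\<lambda>s. \<chi> i. if i = j then r s else 0)"
    have d: "(\<lambda>s. d s $ i) = (if i = j then r else (\<lambda>s. 0))" for i by (auto simp: d_def)
    have bd: "beamformer S d" by (simp add: beamformer_def d r square_integrable_zero)
    have gd: "gain d k i = (if i = j then link S (\<lambda>s. h s $ k) r else 0)" for k i
      by (simp add: d link_zero_right)
    have "margin_slope \<eta> w d $ k = (if k = j then Re (cnj (gain w j j) * link S (\<lambda>s. h s $ j) r)
        else - (\<eta> $ k * Re (cnj (gain w k j) * link S (\<lambda>s. h s $ k) r)))" for k
      unfolding margin_slope_def vec_lambda_beta gd
      by (subst sum.cong[OF refl, where h = "\<lambda>i. if i = j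
          then Re (cnj (gain w k j) * link S (\<lambda>s. h s $ k) r) else 0"])
         (auto simp: sum.delta)
    then have "\<nu> $ k * margin_slope \<eta> w d $ k =
        \<mu> * Re (cnj (b k) * link S (\<lambda>s. h s $ k) r)" for k
      by (simp add: \<nu>m b_def) (simp add: algebra_simps)
    moreover have "power_slope w d = Re (link S (\<lambda>s. w s $ j) r)"
      unfolding power_slope_def d
      by (subst sum.cong[OF refl, where h = "\<lambda>i. if i = j then Re (link S (\<lambda>s. w s $ j) r) else 0"])
         (auto simp: link_zero_right)
    ultimately have "Re (link S (\<lambda>s. w s $ j) r) =
        (\<Sum>k\<in>UNIV. Re (cnj (b k) * link S (\<lambda>s. h s $ k) r))"
      using slopes[OF bd] \<open>\<mu> \<noteq> 0\<close> by (simp flip: sum_distrib_left)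
    moreover have "link S r r =
        link S (\<lambda>s. w s $ j) r - (\<Sum>k\<in>UNIV. cnj (b k) * link S (\<lambda>s. h s $ k) r)"
      by (subst (1) r_def, subst link_diff_left[OF r beamformer_component[OF bw] sq])
         (simp add: link_sum_left[OF r] square_integrable_cmult channel link_cmult_left)
    ultimately have "Re (link S r r) = 0" by simp
    then have "AE s in S. r s = 0" using energy_eq_0_iff[OF r] by (simp add: link_self)
    then show "AE s in S. w s $ j = (\<Sum>k\<in>UNIV.
       (if k = j then m $ j * gain w j j else - (m $ k * \<eta> $ k * gain w k j)) * h s $ k)"
      by (simp add: r_def b_def)
  qed
qed

section \<open>The regularized matrix and the structured beamformer\<close>

lemma channel_correlation_hermitian:
  "channel_correlation S h = conj_transpose (channel_correlation S h)"
  by (simp add: channel_correlation_def conj_transpose_def vec_eq_iff flip: link_commute)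

lemma channel_combination: "square_integrable S (\<lambda>s. \<Sum>i\<in>UNIV. x $ i * h s $ i)"
  by (intro square_integrable_sum square_integrable_cmult channel)

text \<open>With \<open>x\<close> read as coefficients of a combination of the channels, Q x lists
  the links of the channels with that combination. Matrix equations thus become statements about
  functions on the surface.\<close>

lemma regularized_matrix_mult_vec:
  "(regularized_matrix S h \<sigma> l *v x) $ k =
     x $ k + of_real (l $ k / \<sigma>\<^sup>2) * link S (\<lambda>s. h s $ k) (\<lambda>s. \<Sum>i\<in>UNIV. x $ i * h s $ i)"
proof -
  have "(real_diag l ** channel_correlation S h) $ k $ i =
      of_real (l $ k) * channel_correlation S h $ k $ i" for i
    unfolding matrix_matrix_mult_def real_diag_def
    by (simp add: if_distrib[of "\<lambda>x. x * _"] cong: if_cong)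
  then have "regularized_matrix S h \<sigma> l $ k $ i =
      (if k = i then 1 else 0) + of_real (l $ k / \<sigma>\<^sup>2) * channel_correlation S h $ k $ i" for i
    by (simp add: regularized_matrix_def mat_def scaleR_conv_of_real[where 'a = complex])
  then show ?thesis
    by (simp add: matrix_vector_mult_def distrib_right sum.distrib channel_correlation_def
        link_sum_right channel square_integrable_cmult link_cmult_right sum_distrib_left
        mult.assoc if_distrib[of "\<lambda>x. x * _"] cong: if_cong)
       (simp add: mult_ac)
qed

text \<open>For a kernel vector, \<open>x $ k\<close> is minus a non-negative multiple of
  \<open>y k\<close>, so the energy of the combination \<open>F\<close> equals minus a sum of
  non-negative terms. All these terms vanish, and \<open>x\<close> with them. This covers linearly
  dependent channels, where Q is singular.\<close>

lemma invertible_regularized_matrix: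
  assumes l: "\<And>k. 0 \<le> l $ k"
  shows "invertible (regularized_matrix S h \<sigma> l)"
  unfolding invertible_left_inverse matrix_left_invertible_ker
proof (intro allI impI)
  fix x assume 0: "regularized_matrix S h \<sigma> l *v x = 0"
  define F where "F = (\<lambda>s. \<Sum>i\<in>UNIV. x $ i * h s $ i)"
  define y where "y = (\<lambda>k. link S (\<lambda>s. h s $ k) F)"
  define c where "c = (\<lambda>k. l $ k / \<sigma>\<^sup>2)"
  have c: "0 \<le> c k" for k using l by (simp add: c_def)
  have x: "x $ k = - (of_real (c k) * y k)" for k
    using arg_cong[OF 0, of "\<lambda>v. v $ k"]
    by (simp add: regularized_matrix_mult_vec c_def y_def F_def add_eq_0_iff2)
  have F: "square_integrable S F" unfolding F_def by (rule channel_combination)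
  have "link S F F = (\<Sum>k\<in>UNIV. cnj (x $ k) * y k)"
    unfolding y_def by (subst (1) F_def, subst link_sum_left)
      (auto simp: F square_integrable_cmult channel link_cmult_left)
  moreover have "cnj (x $ k) * y k = of_real (- (c k * (cmod (y k))\<^sup>2))" for k
    using complex_norm_square[of "y k"] by (simp add: x mult_ac)
  ultimately have "link S F F = of_real (- (\<Sum>k\<in>UNIV. c k * (cmod (y k))\<^sup>2))"
    by (simp add: sum_negf)
  then have "energy S F = - (\<Sum>k\<in>UNIV. c k * (cmod (y k))\<^sup>2)"
    unfolding link_self of_real_eq_iff .
  with energy_nonneg[of S F] have "(\<Sum>k\<in>UNIV. c k * (cmod (y k))\<^sup>2) \<le> 0" by simp
  moreover have "0 \<le> c k * (cmod (y k))\<^sup>2" for k using c by simp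
  ultimately have "(\<Sum>k\<in>UNIV. c k * (cmod (y k))\<^sup>2) = 0" by (simp add: order_antisym sum_nonneg)
  then have "c k * (cmod (y k))\<^sup>2 = 0" for k using c by (simp add: sum_nonneg_eq_0_iff)
  then have "x $ k = 0" for k using x[of k] by (metis mult_eq_0_iff neg_equal_0_iff_equal
      norm_eq_zero of_real_0 zero_eq_power2)
  then show "x = 0" by (simp add: vec_eq_iff)
qed

lemma structured_beamformer_component:
  "structured_beamformer S h \<sigma> l p s $ k = of_real (sqrt (p $ k)) *
     (\<Sum>i\<in>UNIV. matrix_inv (regularized_matrix S h \<sigma> l) $ i $ k * h s $ i)"
  by (simp add: structured_beamformer_def vector_matrix_mult_def matrix_matrix_mult_def
      real_diag_def if_distrib[of "\<lambda>x. _ * x"] sum_distrib_left mult_ac cong: if_cong)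

lemma beamformer_structured: "beamformer S (structured_beamformer S h \<sigma> l p)"
  unfolding beamformer_def structured_beamformer_component
  by (intro allI square_integrable_cmult square_integrable_sum channel)

text \<open>The vector \<open>x j\<close> is \<open>\<beta> $ j\<close> times a column of the
  inverse matrix. The structured beamformer has the modulus of \<open>\<beta> $ j\<close> in its
  place, so the two differ by the phase of \<open>\<beta> $ j\<close>.\<close>

lemma same_up_to_phases_structured:
  assumes l: "\<And>k. 0 \<le> l $ k"
    and eq: "\<And>j. regularized_matrix S h \<sigma> l *v x j = axis j (\<beta> $ j)"
    and w: "\<And>j. AE s in S. w s $ j = (\<Sum>i\<in>UNIV. x j $ i * h s $ i)"
  shows "same_up_to_phases S w (structured_beamformer S h \<sigma> l (\<chi> j. (cmod (\<beta> $ j))\<^sup>2))"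
proof -
  let ?R = "regularized_matrix S h \<sigma> l"
  have "matrix_inv ?R ** ?R = mat 1"
    using invertible_regularized_matrix[OF l] unfolding invertible_def matrix_inv_def
    by (rule someI2_ex) simp
  then have "x j = matrix_inv ?R *v axis j (\<beta> $ j)" for j
    by (metis eq matrix_vector_mul_assoc matrix_vector_mul_lid)
  then have x: "x j $ i = matrix_inv ?R $ i $ j * \<beta> $ j" for i j
    by (simp add: matrix_vector_mult_def axis_def if_distrib[of "\<lambda>x. _ * x"] cong: if_cong)
  \<comment> \<open>The phase of \<beta>, with the value 1 where \<beta> vanishes so that every
    entry stays unimodular.\<close>
  define c where "c = (\<chi> j. if \<beta> $ j = 0 then 1 else \<beta> $ j / of_real (cmod (\<beta> $ j)))"
  have c: "c $ j * of_real (cmod (\<beta> $ j)) = \<beta> $ j" for j by (simp add: c_def)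
  have "AE s in S. \<forall>j. w s $ j = (\<Sum>i\<in>UNIV. x j $ i * h s $ i)"
    using w by (simp add: AE_all_countable)
  then have "AE s in S. \<forall>j. w s $ j = c $ j *
      structured_beamformer S h \<sigma> l (\<chi> j. (cmod (\<beta> $ j))\<^sup>2) s $ j"
    by eventually_elim
      (simp add: structured_beamformer_component x c flip: mult.assoc, simp add: sum_distrib_left mult_ac)
  moreover have "cmod (c $ j) = 1" for j by (simp add: c_def norm_divide)
  ultimately show ?thesis unfolding same_up_to_phases_def by blast
qed

section \<open>Uniqueness of power optima up to phases\<close>

text \<open>The \<open>j\<close>-th summand of the Lagrangian is a quadratic form whose gradient at \<open>w\<^sub>j\<close> vanishes,
  so it only depends on the part of \<open>e\<close> that \<open>h\<^sub>j\<close> does not see, where it is positive definite.\<close>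

lemma lagrangian_summand_ge:
  fixes c :: "'k \<Rightarrow> real"
  assumes sq: "square_integrable S f" "square_integrable S e"
    and c: "\<And>k. 0 \<le> c k" and gj: "link S (\<lambda>s. h s $ j) f \<noteq> 0"
    and stat: "AE s in S. f s = (\<Sum>k\<in>UNIV. (if k = j then m * link S (\<lambda>s. h s $ j) f
        else - (c k * link S (\<lambda>s. h s $ k) f)) * h s $ k)"
  shows "energy S (\<lambda>s. e s - link S (\<lambda>s. h s $ j) e / link S (\<lambda>s. h s $ j) f * f s) \<le>
    energy S e + (\<Sum>k\<in>UNIV - {j}. c k * (cmod (link S (\<lambda>s. h s $ k) e))\<^sup>2) -
      m * (cmod (link S (\<lambda>s. h s $ j) e))\<^sup>2"
proof -
  define H where "H = (\<lambda>k. link S (\<lambda>s. h s $ k))"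
  \<comment> \<open>The multiple of \<open>f\<close> with the same link to channel \<open>j\<close>
    as \<open>e\<close>; the remainder \<open>u\<close> is therefore invisible to that
    channel.\<close>
  define \<alpha> where "\<alpha> = H j e / H j f"
  define u where "u = (\<lambda>s. e s - \<alpha> * f s)"
  have u: "square_integrable S u"
    unfolding u_def by (intro square_integrable_intros sq)
  have \<alpha>f: "square_integrable S (\<lambda>s. \<alpha> * f s)" by (intro square_integrable_intros sq)
  have He: "H k e = \<alpha> * H k f + H k u" for k
    unfolding u_def H_def by (simp add: link_diff_right[OF channel sq(2) \<alpha>f] link_cmult_right)
  have Hu: "H j u = 0" using He[of j] gj by (simp add: \<alpha>_def H_def)
  have lf: "link S f g = m * cnj (H j f) * H j g - (\<Sum>k\<in>UNIV - {j}. c k * cnj (H k f) * H k g)"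
    if g: "square_integrable S g" for g
  proof -
    let ?b = "\<lambda>k. if k = j then m * H j f else - (c k * H k f)"
    have "AE s in S. f s = (\<Sum>k\<in>UNIV. ?b k * h s $ k)" using stat unfolding H_def .
    then have "link S f g = link S (\<lambda>s. \<Sum>k\<in>UNIV. ?b k * h s $ k) g"
      by (intro link_cong_AE sq g square_integrable_sum square_integrable_cmult channel) auto
    also have "\<dots> = (\<Sum>k\<in>UNIV. cnj (?b k) * H k g)"
      unfolding H_def
      by (simp only: link_sum_left[OF g square_integrable_cmult[OF channel]] link_cmult_left)
    also have "\<dots> = cnj (?b j) * H j g + (\<Sum>k\<in>UNIV - {j}. cnj (?b k) * H k g)"
      by (rule sum.remove) auto
    also have "(\<Sum>k\<in>UNIV - {j}. cnj (?b k) * H k g) = - (\<Sum>k\<in>UNIV - {j}. c k * cnj (H k f) * H k g)"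
      unfolding sum_negf[symmetric] by (rule sum.cong) auto
    finally show ?thesis by simp
  qed
  have cc: "cnj z * z = of_real ((cmod z)\<^sup>2)" for z
    using complex_norm_square[of z] by (simp add: mult.commute)
  have "complex_of_real (energy S f) =
      of_real (m * (cmod (H j f))\<^sup>2 - (\<Sum>k\<in>UNIV - {j}. c k * (cmod (H k f))\<^sup>2))"
    using lf[OF sq(1)] unfolding link_self by (simp add: mult.assoc cc)
  then have ef: "energy S f = m * (cmod (H j f))\<^sup>2 - (\<Sum>k\<in>UNIV - {j}. c k * (cmod (H k f))\<^sup>2)"
    unfolding of_real_eq_iff .
  have lu: "link S f u = - (\<Sum>k\<in>UNIV - {j}. c k * cnj (H k f) * H k u)"
    using lf[OF u] by (simp add: Hu)
  have "energy S e = (cmod \<alpha>)\<^sup>2 * energy S f + energy S u + 2 * Re (cnj \<alpha> * link S f u)"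
    using energy_add[OF \<alpha>f u] by (simp add: u_def energy_cmult link_cmult_left)
  also have "Re (cnj \<alpha> * link S f u) = - (\<Sum>k\<in>UNIV - {j}. c k * Re (cnj (\<alpha> * H k f) * H k u))"
    unfolding lu by (simp add: sum_distrib_left mult_ac flip: sum_negf)
      (auto simp: algebra_simps intro!: sum.cong)
  finally have "energy S e = (cmod \<alpha>)\<^sup>2 * energy S f + energy S u
      - 2 * (\<Sum>k\<in>UNIV - {j}. c k * Re (cnj (\<alpha> * H k f) * H k u))" by simp
  moreover have "(cmod (H k e))\<^sup>2 = (cmod \<alpha>)\<^sup>2 * (cmod (H k f))\<^sup>2 + (cmod (H k u))\<^sup>2
      + 2 * Re (cnj (\<alpha> * H k f) * H k u)" for k
    unfolding He cmod_add_square by (simp add: norm_mult power_mult_distrib)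
  then have "(\<Sum>k\<in>UNIV - {j}. c k * (cmod (H k e))\<^sup>2) =
      (cmod \<alpha>)\<^sup>2 * (\<Sum>k\<in>UNIV - {j}. c k * (cmod (H k f))\<^sup>2) +
      (\<Sum>k\<in>UNIV - {j}. c k * (cmod (H k u))\<^sup>2) +
      2 * (\<Sum>k\<in>UNIV - {j}. c k * Re (cnj (\<alpha> * H k f) * H k u))"
    by (simp only: sum_distrib_left flip: sum.distrib)
       (simp add: algebra_simps)
  moreover have "(cmod (H j e))\<^sup>2 = (cmod \<alpha>)\<^sup>2 * (cmod (H j f))\<^sup>2"
    using He[of j] by (simp add: Hu norm_mult power_mult_distrib)
  moreover have "0 \<le> (\<Sum>k\<in>UNIV - {j}. c k * (cmod (H k u))\<^sup>2)"
    using c by (intro sum_nonneg) auto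
  \<comment> \<open>By \<open>ef\<close> the terms with \<open>(cmod \<alpha>)\<^sup>2\<close>
    cancel, and the cross terms of energy and interference cancel each other. What remains is the
    form evaluated at \<open>u\<close>, which is at least its energy.\<close>
  ultimately have "energy S u \<le> energy S e + (\<Sum>k\<in>UNIV - {j}. c k * (cmod (H k e))\<^sup>2)
      - m * (cmod (H j e))\<^sup>2"
    unfolding ef by (simp add: algebra_simps)
  then show ?thesis by (simp add: u_def \<alpha>_def H_def)
qed

text \<open>Summing the bounds of \<open>lagrangian_summand_ge\<close> and using tightness at
  \<open>v\<close> collapses the Lagrangian to the difference of the two powers, which is not
  positive. Each \<open>v\<close> component is thus a multiple of that of \<open>w\<close>, and
  tightness of both fixes the modulus.\<close>

lemma power_optimal_unique:
  assumes optw: "power_optimal S h \<sigma> \<eta> w" and optv: "power_optimal S h \<sigma> \<eta> v"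
  shows "same_up_to_phases S v w"
proof -
  have bw: "beamformer S w" and bv: "beamformer S v"
    using optw optv by (auto dest: power_optimalD(1))
  obtain m :: "real ^ 'k" where m: "\<And>k. 0 \<le> m $ k" "\<And>k. \<eta> $ k \<le> 0 \<Longrightarrow> m $ k = 0"
    and power: "transmit_power S w = (\<Sum>k\<in>UNIV. m $ k * \<eta> $ k * \<sigma>\<^sup>2)"
    and stat: "\<And>j. AE s in S. w s $ j = (\<Sum>k\<in>UNIV.
       (if k = j then m $ j * gain w j j else - (m $ k * \<eta> $ k * gain w k j)) * h s $ k)"
    using power_optimal_multipliers[OF optw] by blast
  define c where "c = (\<lambda>k. m $ k * \<eta> $ k)"
  have c: "0 \<le> c k" for k using m[of k] by (cases "0 \<le> \<eta> $ k") (auto simp: c_def)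
  have active: "(cmod (gain x k k))\<^sup>2 = \<eta> $ k * (interference x k + \<sigma>\<^sup>2)"
    if "power_optimal S h \<sigma> \<eta> x" "0 < \<eta> $ k" for x k
    using power_optimal_active[OF that] sinr_eq_iff by blast
  have nz: "gain w k k \<noteq> 0" if "0 < \<eta> $ k" for k
    using active[OF optw that] that interference_noise_pos[of k w] by auto
  \<comment> \<open>For a user with a non-positive target both beamformers vanish almost everywhere,
    so the factor can be set to 1.\<close>
  define \<alpha> where "\<alpha> = (\<lambda>j. if 0 < \<eta> $ j then gain v j j / gain w j j else 1)"
  define u where "u = (\<lambda>j s. v s $ j - \<alpha> j * w s $ j)"
  have su: "square_integrable S (u j)" for j
    unfolding u_def by (intro square_integrable_intros beamformer_component bv bw)
  have zero: "AE s in S. w s $ j = 0" "AE s in S. v s $ j = 0" if "\<eta> $ j \<le> 0" for j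
    using power_optimal_inactive[OF optw that] power_optimal_inactive[OF optv that]
    by (simp_all add: energy_eq_0_iff beamformer_component bv bw)
  have "energy S (u j) \<le> energy S (\<lambda>s. v s $ j) +
      (\<Sum>k\<in>UNIV - {j}. c k * (cmod (gain v k j))\<^sup>2) - m $ j * (cmod (gain v j j))\<^sup>2" for j
  proof (cases "0 < \<eta> $ j")
    case True
    show ?thesis
      using lagrangian_summand_ge[where c = c and m = "m $ j", OF beamformer_component[OF bw]
          beamformer_component[OF bv] c nz[OF True]] stat[of j] True
      by (simp add: c_def u_def \<alpha>_def cong: if_cong)
  next
    case False
    then have "AE s in S. u j s = 0"
      using zero[of j] unfolding u_def by (auto elim: eventually_elim2)
    then have "energy S (u j) = 0" using energy_eq_0_iff[OF su] by simp
    moreover have "0 \<le> (\<Sum>k\<in>UNIV - {j}. c k * (cmod (gain v k j))\<^sup>2)"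
      using c by (intro sum_nonneg) auto
    ultimately show ?thesis using m(2)[of j] False energy_nonneg[of S "\<lambda>s. v s $ j"] by simp
  qed
  then have "(\<Sum>j\<in>UNIV. energy S (u j)) \<le> (\<Sum>j\<in>UNIV. energy S (\<lambda>s. v s $ j) +
      (\<Sum>k\<in>UNIV - {j}. c k * (cmod (gain v k j))\<^sup>2) - m $ j * (cmod (gain v j j))\<^sup>2)"
    by (intro sum_mono)
  also have "\<dots> = transmit_power S v + (\<Sum>j\<in>UNIV. \<Sum>k\<in>UNIV - {j}. c k * (cmod (gain v k j))\<^sup>2) -
      (\<Sum>j\<in>UNIV. m $ j * (cmod (gain v j j))\<^sup>2)"
    by (simp add: sum.distrib sum_subtractf transmit_power_energy)
  \<comment> \<open>Exchanging the sums regroups the leakage caused by each beamformer into the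
    interference received by each user.\<close>
  also have "(\<Sum>j\<in>UNIV. \<Sum>k\<in>UNIV - {j}. c k * (cmod (gain v k j))\<^sup>2) =
      (\<Sum>k\<in>UNIV. c k * interference v k)"
  proof -
    have "(\<Sum>j\<in>UNIV. \<Sum>k\<in>UNIV - {j}. c k * (cmod (gain v k j))\<^sup>2) =
        (\<Sum>j\<in>UNIV. \<Sum>k\<in>{k\<in>UNIV. k \<noteq> j}. c k * (cmod (gain v k j))\<^sup>2)"
      by (intro sum.cong) auto
    also have "\<dots> = (\<Sum>k\<in>UNIV. \<Sum>j\<in>{j\<in>UNIV. k \<noteq> j}. c k * (cmod (gain v k j))\<^sup>2)"
      by (rule sum.swap_restrict) auto
    also have "\<dots> = (\<Sum>k\<in>UNIV. c k * interference v k)"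
      unfolding sum_distrib_left by (intro sum.cong) auto
    finally show ?thesis .
  qed
  also have "m $ k * (cmod (gain v k k))\<^sup>2 = c k * interference v k + c k * \<sigma>\<^sup>2" for k
    using active[OF optv, of k] m(2)[of k]
    by (cases "0 < \<eta> $ k") (auto simp: c_def algebra_simps)
  then have "(\<Sum>j\<in>UNIV. m $ j * (cmod (gain v j j))\<^sup>2) =
      (\<Sum>k\<in>UNIV. c k * interference v k) + transmit_power S w"
    by (simp add: sum.distrib power c_def)
  finally have "(\<Sum>j\<in>UNIV. energy S (u j)) \<le> transmit_power S v - transmit_power S w" by simp
  also have "\<dots> \<le> 0"
    using power_optimalD(3)[OF optv bw] power_optimalD(2)[OF optw] by simp
  finally have "(\<Sum>j\<in>UNIV. energy S (u j)) = 0" by (simp add: order_antisym sum_nonneg energy_nonneg)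
  then have "energy S (u j) = 0" for j by (simp add: sum_nonneg_eq_0_iff energy_nonneg)
  then have ae: "AE s in S. v s $ j = \<alpha> j * w s $ j" for j
    using energy_eq_0_iff[OF su] by (simp add: u_def)
  have g: "(cmod (gain v k j))\<^sup>2 = (cmod (\<alpha> j))\<^sup>2 * (cmod (gain w k j))\<^sup>2" for k j
    using gain_phases[OF bv bw ae] by (simp add: norm_mult power_mult_distrib)
  have "(cmod (\<alpha> j))\<^sup>2 = 1" for j
  proof (rule maximum_principle[where x = "\<lambda>j. (cmod (\<alpha> j))\<^sup>2" and a = "\<lambda>k i. (cmod (gain w k i))\<^sup>2"
        and r = "\<sigma>\<^sup>2"])
    fix k
    \<comment> \<open>Both tight constraints are compared and the common positive factor
      \<open>\<eta> $ k\<close> is cancelled.\<close>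
    have "(cmod (\<alpha> k))\<^sup>2 * (interference w k + \<sigma>\<^sup>2) =
        (\<Sum>i\<in>UNIV - {k}. (cmod (\<alpha> i))\<^sup>2 * (cmod (gain w k i))\<^sup>2) + \<sigma>\<^sup>2" if "0 < \<eta> $ k"
      using active[OF optv that] active[OF optw that] that
      by (simp add: g mult.left_commute[of _ "\<eta> $ k"])
    then show "(cmod (\<alpha> k))\<^sup>2 = 1 \<or> (cmod (\<alpha> k))\<^sup>2 * (interference w k + \<sigma>\<^sup>2) =
        (\<Sum>i\<in>UNIV - {k}. (cmod (\<alpha> i))\<^sup>2 * (cmod (gain w k i))\<^sup>2) + \<sigma>\<^sup>2"
      by (cases "0 < \<eta> $ k") (auto simp: \<alpha>_def)
  qed (use noise in auto)
  then have "cmod (\<alpha> j) = 1" for j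
    using power2_eq_imp_eq[of "cmod (\<alpha> j)" 1] by simp
  moreover have "AE s in S. \<forall>j. v s $ j = (\<chi> j. \<alpha> j) $ j * w s $ j"
    using ae by (simp add: AE_all_countable)
  ultimately show ?thesis unfolding same_up_to_phases_def by (intro exI[of _ "\<chi> j. \<alpha> j"]) simp
qed

section \<open>Structure of power optima\<close>

text \<open>The stationarity of one optimum is a linear system with the regularized matrix;
  uniqueness then transfers the same \<open>l\<close> and \<open>p\<close> to all other
  optima.\<close>

lemma power_optimal_structured:
  assumes opt: "power_optimal S h \<sigma> \<eta> w"
  obtains l p where "\<And>k. 0 \<le> l $ k" "\<And>k. 0 \<le> p $ k" "(\<Sum>k\<in>UNIV. l $ k) = transmit_power S w"
    "power_optimal S h \<sigma> \<eta> (structured_beamformer S h \<sigma> l p)"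
    "\<And>v. power_optimal S h \<sigma> \<eta> v \<Longrightarrow> same_up_to_phases S v (structured_beamformer S h \<sigma> l p)"
proof -
  have bw: "beamformer S w" by (rule power_optimalD(1)[OF opt])
  obtain m :: "real ^ 'k" where m: "\<And>k. 0 \<le> m $ k" "\<And>k. \<eta> $ k \<le> 0 \<Longrightarrow> m $ k = 0"
    and power: "transmit_power S w = (\<Sum>k\<in>UNIV. m $ k * \<eta> $ k * \<sigma>\<^sup>2)"
    and stat: "\<And>j. AE s in S. w s $ j = (\<Sum>k\<in>UNIV.
       (if k = j then m $ j * gain w j j else - (m $ k * \<eta> $ k * gain w k j)) * h s $ k)"
    using power_optimal_multipliers[OF opt] by blast
  \<comment> \<open>With this choice the power identity becomes the sum of the \<lambda>-parameters,
    and the matrix factor \<open>l $ k / \<sigma>\<^sup>2\<close> is the interference coefficient of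
    the stationarity equation, so off-diagonal entries cancel.\<close>
  define l where "l = (\<chi> k. m $ k * \<eta> $ k * \<sigma>\<^sup>2)"
  define x where "x = (\<lambda>j. \<chi> k. if k = j then m $ j * gain w j j else - (m $ k * \<eta> $ k * gain w k j))"
  \<comment> \<open>The surviving diagonal entry: the own coefficient plus the contribution of the
    matrix.\<close>
  define \<beta> where "\<beta> = (\<chi> j. of_real (m $ j + m $ j * \<eta> $ j) * gain w j j)"
  define p :: "real ^ 'k" where "p = (\<chi> j. (cmod (\<beta> $ j))\<^sup>2)"
  have l: "0 \<le> l $ k" for k using m[of k] by (cases "0 \<le> \<eta> $ k") (auto simp: l_def)
  have w: "AE s in S. w s $ j = (\<Sum>k\<in>UNIV. x j $ k * h s $ k)" for j
    using stat[of j] by (simp add: x_def)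
  have "regularized_matrix S h \<sigma> l *v x j = axis j (\<beta> $ j)" for j
  proof -
    have "link S (\<lambda>s. h s $ k) (\<lambda>s. \<Sum>i\<in>UNIV. x j $ i * h s $ i) = gain w k j" for k
      by (rule link_cong_AE[OF channel channel channel_combination beamformer_component[OF bw]])
         (use w[of j] in auto)
    then show ?thesis
      using noise
      by (simp add: vec_eq_iff regularized_matrix_mult_vec l_def x_def \<beta>_def axis_def algebra_simps)
  qed
  then have same: "same_up_to_phases S w (structured_beamformer S h \<sigma> l p)"
    unfolding p_def using l w by (intro same_up_to_phases_structured[where x = x])
  show thesis
  proof
    show "0 \<le> l $ k" for k by (rule l)
    show "0 \<le> p $ k" for k by (simp add: p_def)
    show "(\<Sum>k\<in>UNIV. l $ k) = transmit_power S w" by (simp add: l_def power)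
    show "power_optimal S h \<sigma> \<eta> (structured_beamformer S h \<sigma> l p)"
      by (rule power_optimal_same_up_to_phases[OF opt beamformer_structured same_up_to_phases_sym[OF same]])
    show "same_up_to_phases S v (structured_beamformer S h \<sigma> l p)"
      if "power_optimal S h \<sigma> \<eta> v" for v
      by (rule same_up_to_phases_trans[OF power_optimal_unique[OF opt that] same])
  qed
qed

section \<open>From utility optima to power optima\<close>

lemma utility_optimalD:
  assumes "utility_optimal S h \<sigma> U P w"
  shows "beamformer S w" "transmit_power S w \<le> P"
    "\<lbrakk>beamformer S v; transmit_power S v \<le> P\<rbrakk> \<Longrightarrow> U (sinr S h \<sigma> v) \<le> U (sinr S h \<sigma> w)"
  using assms by (auto simp: utility_optimal_def is_arg_max_def not_less)

text \<open>Spare power can always be spent profitably: by amplifying all beamformers, or, if no user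
  receives anything, by serving one user with a non-zero channel.\<close>

lemma slack_improvable:
  assumes U: "strictly_increasing_in_each U" and bw: "beamformer S w"
    and slack: "transmit_power S w < P" and nz: "energy S (\<lambda>s. h s $ n) \<noteq> 0"
  obtains v where "beamformer S v" "transmit_power S v \<le> P" "U (sinr S h \<sigma> w) < U (sinr S h \<sigma> v)"
proof (cases "\<exists>k. gain w k k \<noteq> 0")
  case True
  then obtain k where k: "gain w k k \<noteq> 0" by blast
  \<comment> \<open>The power factor that uses up the budget; the value 2 avoids a division by
    zero.\<close>
  define r where "r = (if transmit_power S w = 0 then 2 else P / transmit_power S w)"
  have r: "1 < r" "r * transmit_power S w \<le> P"
    using slack transmit_power_nonneg[of S w] by (auto simp: r_def)
  define v where "v = (\<lambda>s. sqrt r *\<^sub>R w s)"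
  have v: "(\<lambda>s. v s $ i) = (\<lambda>s. of_real (sqrt r) * w s $ i)" for i
    by (simp add: v_def scaleR_conv_of_real[where 'a = complex])
  have bv: "beamformer S v" using bw by (simp add: beamformer_def v square_integrable_cmult)
  have g: "(cmod (gain v j i))\<^sup>2 = r * (cmod (gain w j i))\<^sup>2" for j i
    using r by (simp add: v link_cmult_right norm_mult power_mult_distrib)
  have pv: "transmit_power S v \<le> P"
    using r by (simp add: transmit_power_energy v energy_cmult flip: sum_distrib_left)
  have iv: "interference v j = r * interference w j" for j by (simp add: g sum_distrib_left)
  have sv: "sinr S h \<sigma> v $ j = r * (cmod (gain w j j))\<^sup>2 / (r * interference w j + \<sigma>\<^sup>2)" for j
    by (simp add: sinr_def g sum_distrib_left)
  have "0 < r * interference w j + \<sigma>\<^sup>2" for j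
    using interference_noise_pos[of j v] unfolding iv .
  \<comment> \<open>Amplifying everything by \<open>r\<close> acts like dividing the noise by
    \<open>r\<close>; after cross-multiplication only the noise terms differ.\<close>
  then have cmp: "x / (interference w j + \<sigma>\<^sup>2) \<le> r * x / (r * interference w j + \<sigma>\<^sup>2) \<longleftrightarrow>
      x * \<sigma>\<^sup>2 \<le> r * (x * \<sigma>\<^sup>2)"
      "x / (interference w j + \<sigma>\<^sup>2) < r * x / (r * interference w j + \<sigma>\<^sup>2) \<longleftrightarrow>
      x * \<sigma>\<^sup>2 < r * (x * \<sigma>\<^sup>2)" for x j
    using interference_noise_pos[of j w] by (simp_all add: divide_simps) (simp_all add: algebra_simps)
  have "sinr S h \<sigma> w $ j \<le> sinr S h \<sigma> v $ j" for j
    unfolding sv unfolding sinr_def vec_lambda_beta cmp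
    using r by (simp add: mult_le_cancel_right1 not_less)
  moreover have "sinr S h \<sigma> w $ k < sinr S h \<sigma> v $ k"
    unfolding sv unfolding sinr_def vec_lambda_beta cmp
    using r k noise by simp
  ultimately have "U (sinr S h \<sigma> w) < U (sinr S h \<sigma> v)"
    by (intro strictly_increasing_strict_mono[OF U sinr_nonneg])
  with bv pv show thesis by (rule that)
next
  case False
  then have sw: "sinr S h \<sigma> w $ j = 0" for j by (simp add: sinr_def)
  define r where "r = P / energy S (\<lambda>s. h s $ n)"
  have r: "0 < r" "r * energy S (\<lambda>s. h s $ n) = P"
    using nz energy_nonneg[of S "\<lambda>s. h s $ n"] slack transmit_power_nonneg[of S w]
    by (auto simp: r_def)
  \<comment> \<open>User \<open>n\<close> is served along its own channel with the whole budget. No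
    other SINR can fall, since all were zero.\<close>
  define v where "v = (\<lambda>s. \<chi> i. if i = n then of_real (sqrt r) * h s $ n else 0)"
  have v: "(\<lambda>s. v s $ i) = (if i = n then (\<lambda>s. of_real (sqrt r) * h s $ n) else (\<lambda>s. 0))" for i
    by (auto simp: v_def)
  have bv: "beamformer S v"
    by (simp add: beamformer_def v square_integrable_intros channel)
  have "energy S (\<lambda>s. v s $ i) = (if i = n then P else 0)" for i
    using r by (simp add: v energy_cmult energy_zero)
  then have pv: "transmit_power S v \<le> P" by (simp add: transmit_power_energy)
  have "gain v n n \<noteq> 0" using r nz by (simp add: v link_cmult_right link_self)
  then have "0 < sinr S h \<sigma> v $ n"
    using interference_noise_pos[of n v] by (simp add: sinr_def)
  then have "U (sinr S h \<sigma> w) < U (sinr S h \<sigma> v)"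
    by (intro strictly_increasing_strict_mono[OF U sinr_nonneg]) (auto simp: sw sinr_nonneg)
  with bv pv show thesis by (rule that)
qed

text \<open>Any beamformer within the budget whose SINRs are at least those of \<open>w\<close> has
  at least the same utility. By \<open>slack_improvable\<close> it must spend all of
  \<open>P\<close>, so none meets these SINRs with less power.\<close>

lemma utility_optimal_imp_power_optimal:
  assumes U: "strictly_increasing_in_each U" and opt: "utility_optimal S h \<sigma> U P w"
    and nz: "energy S (\<lambda>s. h s $ n) \<noteq> 0"
  shows "transmit_power S w = P" "power_optimal S h \<sigma> (sinr S h \<sigma> w) w"
proof -
  note bw = utility_optimalD(1)[OF opt]
  have full: "transmit_power S v = P"
    if bv: "beamformer S v" and pv: "transmit_power S v \<le> P"
      and le: "\<And>k. sinr S h \<sigma> w $ k \<le> sinr S h \<sigma> v $ k" for v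
  proof (rule ccontr)
    assume "transmit_power S v \<noteq> P"
    with pv have "transmit_power S v < P" by simp
    from slack_improvable[OF U bv this nz] obtain x where
      x: "beamformer S x" "transmit_power S x \<le> P" "U (sinr S h \<sigma> v) < U (sinr S h \<sigma> x)" .
    have "U (sinr S h \<sigma> w) \<le> U (sinr S h \<sigma> v)"
      by (rule strictly_increasing_mono[OF U sinr_nonneg le])
    with x(3) utility_optimalD(3)[OF opt x(1,2)] show False by simp
  qed
  show P: "transmit_power S w = P" by (rule full[OF bw utility_optimalD(2)[OF opt]]) simp
  show "power_optimal S h \<sigma> (sinr S h \<sigma> w) w"
    unfolding power_optimal_def is_arg_min_def using bw full P by force
qed

text \<open>All gains vanish, so every beamformer has SINR zero and silence is optimal in both
  problems. The free \<open>l\<close> can later be chosen to sum to \<open>P\<close>.\<close>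

lemma utility_optimal_null_channel:
  fixes l :: "real ^ 'k"
  assumes opt: "utility_optimal S h \<sigma> U P w" and null: "AE s in S. h s = 0"
  defines "v0 \<equiv> structured_beamformer S h \<sigma> l 0"
  shows "utility_optimal S h \<sigma> U P v0" "power_optimal S h \<sigma> (sinr S h \<sigma> w) v0"
    "power_optimal S h \<sigma> (sinr S h \<sigma> w) v \<Longrightarrow> same_up_to_phases S v v0"
proof -
  have g: "gain x k i = 0" if "beamformer S x" for x k i
  proof -
    have "gain x k i = link S (\<lambda>s. 0) (\<lambda>s. x s $ i)"
      using null by (intro link_cong_AE channel square_integrable_zero beamformer_component that)
        (auto elim: eventually_mono)
    then show ?thesis by (simp add: link_def)
  qed
  then have s: "sinr S h \<sigma> x = 0" if "beamformer S x" for x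
    using that by (simp add: sinr_def vec_eq_iff)
  have b0: "beamformer S v0" unfolding v0_def by (rule beamformer_structured)
  have v0: "v0 s $ k = 0" for s k
    by (simp add: v0_def structured_beamformer_component)
  then have p0: "transmit_power S v0 = 0" by (simp add: transmit_power_energy energy_zero)
  note bw = utility_optimalD(1)[OF opt]
  show "utility_optimal S h \<sigma> U P v0"
    using opt b0 s p0 order_trans[OF transmit_power_nonneg utility_optimalD(2)[OF opt]]
    by (auto simp: utility_optimal_def is_arg_max_def)
  show "power_optimal S h \<sigma> (sinr S h \<sigma> w) v0"
    using b0 s bw p0 transmit_power_nonneg
    by (auto simp: power_optimal_def is_arg_min_def not_less)
  then show "same_up_to_phases S v v0" if "power_optimal S h \<sigma> (sinr S h \<sigma> w) v"
    using that by (rule power_optimal_unique)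
qed

end

theorem theorem1:
  fixes S :: "'a measure"
    and h :: "'a \<Rightarrow> complex ^ 'k::finite"
    and U :: "real ^ 'k \<Rightarrow> real"
    and \<sigma> P :: real
  assumes channel: "\<forall>k. square_integrable S (\<lambda>s. h s $ k)"
    and noise: "0 < \<sigma>"
    and utility: "strictly_increasing_in_each U"
  shows
    "channel_correlation S h = conj_transpose (channel_correlation S h) \<and>
     (\<forall>w. utility_optimal S h \<sigma> U P w \<longrightarrow>
       (\<exists>l p. (\<forall>k. 0 \<le> l $ k) \<and> (\<forall>k. 0 \<le> p $ k) \<and> (\<Sum>k \<in> UNIV. l $ k) = P \<and>
          invertible (regularized_matrix S h \<sigma> l) \<and>
          utility_optimal S h \<sigma> U P (structured_beamformer S h \<sigma> l p) \<and>
          power_optimal S h \<sigma> (sinr S h \<sigma> w) (structured_beamformer S h \<sigma> l p) \<and>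
          (\<not> (AE s in S. h s = 0) \<longrightarrow>
             same_up_to_phases S w (structured_beamformer S h \<sigma> l p)) \<and>
          (\<forall>v. power_optimal S h \<sigma> (sinr S h \<sigma> w) v \<longrightarrow>
             same_up_to_phases S v (structured_beamformer S h \<sigma> l p)))) \<and>
     (\<forall>\<eta> w. power_optimal S h \<sigma> \<eta> w \<longrightarrow>
       (\<exists>l p. (\<forall>k. 0 \<le> l $ k) \<and> (\<forall>k. 0 \<le> p $ k) \<and> (\<Sum>k \<in> UNIV. l $ k) = transmit_power S w \<and>
          invertible (regularized_matrix S h \<sigma> l) \<and>
          power_optimal S h \<sigma> \<eta> (structured_beamformer S h \<sigma> l p) \<and>
          same_up_to_phases S w (structured_beamformer S h \<sigma> l p)))"
proof -
  interpret radiating_surface S h \<sigma>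
    using channel noise by unfold_locales auto
  show ?thesis
  proof (intro conjI allI impI)
    show "channel_correlation S h = conj_transpose (channel_correlation S h)"
      by (rule channel_correlation_hermitian)
  next
    fix w assume opt: "utility_optimal S h \<sigma> U P w"
    show "\<exists>l p. (\<forall>k. 0 \<le> l $ k) \<and> (\<forall>k. 0 \<le> p $ k) \<and> (\<Sum>k \<in> UNIV. l $ k) = P \<and>
          invertible (regularized_matrix S h \<sigma> l) \<and>
          utility_optimal S h \<sigma> U P (structured_beamformer S h \<sigma> l p) \<and>
          power_optimal S h \<sigma> (sinr S h \<sigma> w) (structured_beamformer S h \<sigma> l p) \<and>
          (\<not> (AE s in S. h s = 0) \<longrightarrow>
             same_up_to_phases S w (structured_beamformer S h \<sigma> l p)) \<and>
          (\<forall>v. power_optimal S h \<sigma> (sinr S h \<sigma> w) v \<longrightarrow>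
             same_up_to_phases S v (structured_beamformer S h \<sigma> l p))"
    proof (cases "AE s in S. h s = 0")
      case True
      \<comment> \<open>With \<open>p = 0\<close> the beamformer is zero whatever \<open>l\<close>
        is, so the whole budget is assigned to one arbitrary user.\<close>
      define l :: "real ^ 'k" where "l = axis undefined P"
      have "0 \<le> P" using order_trans[OF transmit_power_nonneg utility_optimalD(2)[OF opt]] .
      then have l: "0 \<le> l $ k" for k by (simp add: l_def axis_def)
      have "(\<Sum>k\<in>UNIV. l $ k) = P" by (simp add: l_def axis_def)
      then show ?thesis
        using l True invertible_regularized_matrix[of l] utility_optimal_null_channel[OF opt True]
        by (intro exI[of _ l] exI[of _ 0]) auto
    next
      case False
      then have "\<not> (\<forall>k. AE s in S. h s $ k = 0)"
        by (simp add: vec_eq_iff AE_all_countable)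
      then obtain n where nz: "energy S (\<lambda>s. h s $ n) \<noteq> 0"
        using energy_eq_0_iff[OF radiating_surface.channel[OF radiating_surface_axioms]] by blast
      note po = utility_optimal_imp_power_optimal[OF utility opt nz]
      obtain l p where lp: "\<And>k. 0 \<le> l $ k" "\<And>k. 0 \<le> p $ k" "(\<Sum>k\<in>UNIV. l $ k) = transmit_power S w"
        "power_optimal S h \<sigma> (sinr S h \<sigma> w) (structured_beamformer S h \<sigma> l p)"
        "\<And>v. power_optimal S h \<sigma> (sinr S h \<sigma> w) v \<Longrightarrow> same_up_to_phases S v (structured_beamformer S h \<sigma> l p)"
        using power_optimal_structured[OF po(2)] by blast
      \<comment> \<open>Since \<open>w\<close> is power-optimal for its own SINRs, it agrees with
        the structured beamformer up to phases, which preserve utility and power.\<close>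
      have "utility_optimal S h \<sigma> U P (structured_beamformer S h \<sigma> l p)"
        by (rule utility_optimal_same_up_to_phases[OF opt beamformer_structured
              same_up_to_phases_sym[OF lp(5)[OF po(2)]]])
      with lp po invertible_regularized_matrix[of l] show ?thesis
        by (intro exI[of _ l] exI[of _ p]) auto
    qed
  next
    fix \<eta> w assume opt: "power_optimal S h \<sigma> \<eta> w"
    obtain l p where lp: "\<And>k. 0 \<le> l $ k" "\<And>k. 0 \<le> p $ k" "(\<Sum>k\<in>UNIV. l $ k) = transmit_power S w"
      "power_optimal S h \<sigma> \<eta> (structured_beamformer S h \<sigma> l p)"
      "\<And>v. power_optimal S h \<sigma> \<eta> v \<Longrightarrow> same_up_to_phases S v (structured_beamformer S h \<sigma> l p)"
      using power_optimal_structured[OF opt] by blast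
    with opt invertible_regularized_matrix[of l]
    show "\<exists>l p. (\<forall>k. 0 \<le> l $ k) \<and> (\<forall>k. 0 \<le> p $ k) \<and> (\<Sum>k \<in> UNIV. l $ k) = transmit_power S w \<and>
          invertible (regularized_matrix S h \<sigma> l) \<and>
          power_optimal S h \<sigma> \<eta> (structured_beamformer S h \<sigma> l p) \<and>
          same_up_to_phases S w (structured_beamformer S h \<sigma> l p)"
      by (intro exI[of _ l] exI[of _ p]) auto
  qed
qed

end
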